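(* Let $B$ be a braided group with product $\cdot$, unit $\eta$, coproduct $\Delta$, counit $\epsilon$ and antipode $S$. Assume that $S$ is invertible and that $B$ has a dual $B^*$ with evaluation $\mathrm{ev}:B^*\otimes B\to\mathbb{C}$ and coevaluation $\mathrm{coev}:\mathbb{C}\to B\otimes B^*$. Define $\int:B\to\mathbb{C}$ by $\int b=\underline{\mathrm{Tr}}(L_b\circ S^2)$, where $L_b$ is left multiplication by $b$ and $\underline{\mathrm{Tr}}$ is the braided trace, i.e. $$\int=\mathrm{ev}\circ\Psi_{B,B^*}\circ(\cdot\otimes\mathrm{id}_{B^*})\circ(\mathrm{id}_B\otimes S^2\otimes\mathrm{id}_{B^*})\circ(\mathrm{id}_B\otimes\mathrm{coev}).$$ Then $\int$ is left-invariant: $$\Big(\mathrm{id}\otimes\int\Big)\circ\Delta=\eta\circ\int ,$$ i.e. $(\mathrm{id}\otimes\int)\Delta(b)=1\int b$ for all $b\in B$.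
   Context: We work in a braided monoidal category whose objects are complex vector spaces (possibly with additional structure), whose morphisms are certain linear maps, whose tensor product is the usual one on underlying spaces, and whose unit object is $\mathbb{C}$; the braiding is denoted $\Psi_{X,Y}:X\otimes Y\to Y\otimes X$. A braided group means a Hopf algebra $B$ in this category: $B$ is a unital associative algebra and a counital coassociative coalgebra with all structure maps $\cdot,\eta,\Delta,\epsilon,S$ morphisms; $\Delta:B\to B\,\underline{\otimes}\,B$ and $\epsilon:B\to\mathbb{C}$ are algebra homomorphisms, where $B\,\underline{\otimes}\,B$ is $B\otimes B$ with the braided tensor product algebra structure $(\cdot\otimes\cdot)\circ(\mathrm{id}\otimes\Psi_{B,B}\otimes\mathrm{id})$; and the antipode obeys $\cdot\circ(S\otimes\mathrm{id})\circ\Delta=\eta\circ\epsilon=\cdot\circ(\mathrm{id}\otimes S)\circ\Delta$. The dual $B^*$ is an object with morphisms $\mathrm{ev}:B^*\otimes B\to\mathbb{C}$, $\mathrm{coev}:\mathbb{C}\to B\otimes B^*$ satisfying $(\mathrm{id}_B\otimes\mathrm{ev})(\mathrm{coev}\otimes\mathrm{id}_B)=\mathrm{id}_B$ and $(\mathrm{ev}\otimes\mathrm{id}_{B^*})(\mathrm{id}_{B^*}\otimes\mathrm{coev})=\mathrm{id}_{B^*}$; concretely $\mathrm{coev}(1)=\sum_a e_a\otimes f^a$ for a basis $\{e_a\}$ of $B$ with dual basis $\{f^a\}$. The braided trace of an endomorphism $f$ of $B$ is $\underline{\mathrm{Tr}}(f)=\mathrm{ev}\circ\Psi_{B,B^*}\circ(f\otimes\mathrm{id})\circ\mathrm{coev}$.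 *)

theory Defs
  imports Complex_Main
begin

text \<open>
  A category of complex vector spaces with additional structure. Objects are the elements of a
  type, and \<open>vspace C X\<close> is the vector space underlying \<open>X\<close>. All underlying spaces are taken inside
  one ambient complex vector space \<open>'v\<close>, which costs nothing: a set of vector spaces
  embeds in its direct sum. Only the values of an element of \<open>hom C X Y\<close> on \<open>vspace C X\<close> matter.
  The unit object is \<open>\<complex>\<close>, with \<open>unit_vec C\<close> the number 1, and \<open>pure C X Y x y\<close> is the pure
  tensor of \<open>x\<close> and \<open>y\<close> in \<open>X \<otimes> Y\<close>.
\<close>

record ('o, 'v) vect_cat =
  scal :: "complex \<Rightarrow> 'v \<Rightarrow> 'v"
  vspace :: "'o \<Rightarrow> 'v set"
  hom :: "'o \<Rightarrow> 'o \<Rightarrow> ('v \<Rightarrow> 'v) set"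
  tensor :: "'o \<Rightarrow> 'o \<Rightarrow> 'o"  (infixr "\<otimes>\<index>" 70)
  pure :: "'o \<Rightarrow> 'o \<Rightarrow> 'v \<Rightarrow> 'v \<Rightarrow> 'v"
  unit_ob :: "'o"  ("\<one>\<index>")
  unit_vec :: "'v"
  braid :: "'o \<Rightarrow> 'o \<Rightarrow> 'v \<Rightarrow> 'v"

definition linear_map ::
    "('o, 'v::ab_group_add, 'm) vect_cat_scheme \<Rightarrow> 'v set \<Rightarrow> 'v set \<Rightarrow> ('v \<Rightarrow> 'v) \<Rightarrow> bool" where
  "linear_map C S T f \<longleftrightarrow>
     (\<forall>x\<in>S. f x \<in> T) \<and>
     (\<forall>x\<in>S. \<forall>y\<in>S. f (x + y) = f x + f y) \<and>
     (\<forall>c. \<forall>x\<in>S. f (scal C c x) = scal C c (f x))"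

definition bilinear_map ::
    "('o, 'v::ab_group_add, 'm) vect_cat_scheme \<Rightarrow> 'v set \<Rightarrow> 'v set \<Rightarrow> 'v set \<Rightarrow>
     ('v \<Rightarrow> 'v \<Rightarrow> 'v) \<Rightarrow> bool" where
  "bilinear_map C S T W b \<longleftrightarrow>
     (\<forall>x\<in>S. linear_map C T W (b x)) \<and> (\<forall>y\<in>T. linear_map C S W (\<lambda>x. b x y))"

text \<open>The linear map on \<open>X \<otimes> Y\<close> induced by a bilinear map on \<open>X \<times> Y\<close>.\<close>

definition lift ::
    "('o, 'v::ab_group_add, 'm) vect_cat_scheme \<Rightarrow> 'o \<Rightarrow> 'o \<Rightarrow> ('v \<Rightarrow> 'v \<Rightarrow> 'v) \<Rightarrow> 'v \<Rightarrow> 'v" where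
  "lift C X Y b = (SOME h. linear_map C (vspace C (X \<otimes>\<^bsub>C\<^esub> Y)) UNIV h \<and>
     (\<forall>x\<in>vspace C X. \<forall>y\<in>vspace C Y. h (pure C X Y x y) = b x y))"

text \<open>\<open>tmap C X X' Y Y' f g\<close> is \<open>f \<otimes> g : X \<otimes> Y \<rightarrow> X' \<otimes> Y'\<close> for \<open>f : X \<rightarrow> X'\<close> and \<open>g : Y \<rightarrow> Y'\<close>.\<close>

definition tmap ::
    "('o, 'v::ab_group_add, 'm) vect_cat_scheme \<Rightarrow> 'o \<Rightarrow> 'o \<Rightarrow> 'o \<Rightarrow> 'o \<Rightarrow>
     ('v \<Rightarrow> 'v) \<Rightarrow> ('v \<Rightarrow> 'v) \<Rightarrow> 'v \<Rightarrow> 'v" where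
  "tmap C X X' Y Y' f g = lift C X Y (\<lambda>x y. pure C X' Y' (f x) (g y))"

text \<open>\<open>(X \<otimes> Y) \<otimes> Z \<rightarrow> X \<otimes> (Y \<otimes> Z)\<close> and its inverse.\<close>

definition assoc ::
    "('o, 'v::ab_group_add, 'm) vect_cat_scheme \<Rightarrow> 'o \<Rightarrow> 'o \<Rightarrow> 'o \<Rightarrow> 'v \<Rightarrow> 'v" where
  "assoc C X Y Z = lift C (X \<otimes>\<^bsub>C\<^esub> Y) Z
     (\<lambda>w z. lift C X Y (\<lambda>x y. pure C X (Y \<otimes>\<^bsub>C\<^esub> Z) x (pure C Y Z y z)) w)"

definition assoc_inv ::
    "('o, 'v::ab_group_add, 'm) vect_cat_scheme \<Rightarrow> 'o \<Rightarrow> 'o \<Rightarrow> 'o \<Rightarrow> 'v \<Rightarrow> 'v" where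
  "assoc_inv C X Y Z = lift C X (Y \<otimes>\<^bsub>C\<^esub> Z)
     (\<lambda>x w. lift C Y Z (\<lambda>y z. pure C (X \<otimes>\<^bsub>C\<^esub> Y) Z (pure C X Y x y) z) w)"

text \<open>The complex number represented by an element of the unit object.\<close>

definition coeff :: "('o, 'v::ab_group_add, 'm) vect_cat_scheme \<Rightarrow> 'v \<Rightarrow> complex" where
  "coeff C v = (THE c. v = scal C c (unit_vec C))"

definition lunit :: "('o, 'v::ab_group_add, 'm) vect_cat_scheme \<Rightarrow> 'o \<Rightarrow> 'v \<Rightarrow> 'v" where
  "lunit C X = lift C \<one>\<^bsub>C\<^esub> X (\<lambda>v x. scal C (coeff C v) x)"

definition runit :: "('o, 'v::ab_group_add, 'm) vect_cat_scheme \<Rightarrow> 'o \<Rightarrow> 'v \<Rightarrow> 'v" where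
  "runit C X = lift C X \<one>\<^bsub>C\<^esub> (\<lambda>x v. scal C (coeff C v) x)"

definition lunit_inv :: "('o, 'v::ab_group_add, 'm) vect_cat_scheme \<Rightarrow> 'o \<Rightarrow> 'v \<Rightarrow> 'v" where
  "lunit_inv C X x = pure C \<one>\<^bsub>C\<^esub> X (unit_vec C) x"

definition runit_inv :: "('o, 'v::ab_group_add, 'm) vect_cat_scheme \<Rightarrow> 'o \<Rightarrow> 'v \<Rightarrow> 'v" where
  "runit_inv C X x = pure C X \<one>\<^bsub>C\<^esub> x (unit_vec C)"

definition map_eq ::
    "('o, 'v::ab_group_add, 'm) vect_cat_scheme \<Rightarrow> 'o \<Rightarrow> ('v \<Rightarrow> 'v) \<Rightarrow> ('v \<Rightarrow> 'v) \<Rightarrow> bool" where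
  "map_eq C X f g \<longleftrightarrow> (\<forall>x\<in>vspace C X. f x = g x)"

definition invertible_hom ::
    "('o, 'v::ab_group_add, 'm) vect_cat_scheme \<Rightarrow> 'o \<Rightarrow> 'o \<Rightarrow> ('v \<Rightarrow> 'v) \<Rightarrow> bool" where
  "invertible_hom C X Y f \<longleftrightarrow>
     f \<in> hom C X Y \<and> (\<exists>g\<in>hom C Y X. map_eq C X (g \<circ> f) id \<and> map_eq C Y (f \<circ> g) id)"

text \<open>
  The tensor product of spaces is characterized by its universal property. The pentagon and
  triangle identities, the functoriality of \<open>\<otimes>\<close> and the naturality of the associator and unitors
  are not assumed, since they hold automatically for the usual tensor product of vector spaces.
\<close>

locale monoidal_vect_cat =
  fixes C :: "('o, 'v::ab_group_add, 'm) vect_cat_scheme" (structure)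
  assumes vector_space_scal: "vector_space (scal C)"
    and subspace_space: "module.subspace (scal C) (vspace C X)"
    and unit_vec_nonzero: "unit_vec C \<noteq> 0"
    and space_unit: "vspace C \<one> = range (\<lambda>c. scal C c (unit_vec C))"
    and bilinear_pure: "bilinear_map C (vspace C X) (vspace C Y) (vspace C (X \<otimes> Y)) (pure C X Y)"
    and tensor_universal:
      "module.subspace (scal C) W \<Longrightarrow> bilinear_map C (vspace C X) (vspace C Y) W b \<Longrightarrow>
       \<exists>h. linear_map C (vspace C (X \<otimes> Y)) W h \<and>
           (\<forall>x\<in>vspace C X. \<forall>y\<in>vspace C Y. h (pure C X Y x y) = b x y) \<and>
           (\<forall>h'. linear_map C (vspace C (X \<otimes> Y)) W h' \<and>
                 (\<forall>x\<in>vspace C X. \<forall>y\<in>vspace C Y. h' (pure C X Y x y) = b x y) \<longrightarrow>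
                 map_eq C (X \<otimes> Y) h' h)"
    and hom_linear: "f \<in> hom C X Y \<Longrightarrow> linear_map C (vspace C X) (vspace C Y) f"
    and hom_cong: "f \<in> hom C X Y \<Longrightarrow> map_eq C X f g \<Longrightarrow> g \<in> hom C X Y"
    and id_hom: "id \<in> hom C X X"
    and comp_hom: "f \<in> hom C X Y \<Longrightarrow> g \<in> hom C Y Z \<Longrightarrow> g \<circ> f \<in> hom C X Z"
    and tmap_hom:
      "f \<in> hom C X X' \<Longrightarrow> g \<in> hom C Y Y' \<Longrightarrow> tmap C X X' Y Y' f g \<in> hom C (X \<otimes> Y) (X' \<otimes> Y')"
    and assoc_hom: "assoc C X Y Z \<in> hom C ((X \<otimes> Y) \<otimes> Z) (X \<otimes> Y \<otimes> Z)"
    and assoc_inv_hom: "assoc_inv C X Y Z \<in> hom C (X \<otimes> Y \<otimes> Z) ((X \<otimes> Y) \<otimes> Z)"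
    and lunit_hom: "lunit C X \<in> hom C (\<one> \<otimes> X) X"
    and lunit_inv_hom: "lunit_inv C X \<in> hom C X (\<one> \<otimes> X)"
    and runit_hom: "runit C X \<in> hom C (X \<otimes> \<one>) X"
    and runit_inv_hom: "runit_inv C X \<in> hom C X (X \<otimes> \<one>)"

locale braided_vect_cat = monoidal_vect_cat +
  assumes braid_invertible: "invertible_hom C (X \<otimes> Y) (Y \<otimes> X) (braid C X Y)"
    and braid_natural:
      "f \<in> hom C X X' \<Longrightarrow> g \<in> hom C Y Y' \<Longrightarrow>
       map_eq C (X \<otimes> Y) (braid C X' Y' \<circ> tmap C X X' Y Y' f g)
                         (tmap C Y Y' X X' g f \<circ> braid C X Y)"
    and hexagon1:
      "map_eq C ((X \<otimes> Y) \<otimes> Z)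
         (assoc C Y Z X \<circ> braid C X (Y \<otimes> Z) \<circ> assoc C X Y Z)
         (tmap C Y Y (X \<otimes> Z) (Z \<otimes> X) id (braid C X Z) \<circ> assoc C Y X Z \<circ>
          tmap C (X \<otimes> Y) (Y \<otimes> X) Z Z (braid C X Y) id)"
    and hexagon2:
      "map_eq C (X \<otimes> Y \<otimes> Z)
         (assoc_inv C Z X Y \<circ> braid C (X \<otimes> Y) Z \<circ> assoc_inv C X Y Z)
         (tmap C (X \<otimes> Z) (Z \<otimes> X) Y Y (braid C X Z) id \<circ> assoc_inv C X Z Y \<circ>
          tmap C X X (Y \<otimes> Z) (Z \<otimes> Y) id (braid C Y Z))"

text \<open>
  The product \<open>(m \<otimes> m) \<circ> (id \<otimes> \<Psi> \<otimes> id)\<close> of the braided tensor product algebra of \<open>B\<close> with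
  itself, with domain \<open>(B \<otimes> B) \<otimes> (B \<otimes> B)\<close>.
\<close>

definition braided_tensor_mult ::
    "('o, 'v::ab_group_add, 'm) vect_cat_scheme \<Rightarrow> 'o \<Rightarrow> ('v \<Rightarrow> 'v) \<Rightarrow> 'v \<Rightarrow> 'v" where
  "braided_tensor_mult C B m =
     tmap C (B \<otimes>\<^bsub>C\<^esub> B) B (B \<otimes>\<^bsub>C\<^esub> B) B m m \<circ>
     assoc_inv C B B (B \<otimes>\<^bsub>C\<^esub> B) \<circ>
     tmap C B B (B \<otimes>\<^bsub>C\<^esub> B \<otimes>\<^bsub>C\<^esub> B) (B \<otimes>\<^bsub>C\<^esub> B \<otimes>\<^bsub>C\<^esub> B) id
       (assoc C B B B \<circ>
        tmap C (B \<otimes>\<^bsub>C\<^esub> B) (B \<otimes>\<^bsub>C\<^esub> B) B B (braid C B B) id \<circ>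
        assoc_inv C B B B) \<circ>
     assoc C B B (B \<otimes>\<^bsub>C\<^esub> B)"

locale braided_group = braided_vect_cat C
  for C :: "('o, 'v::ab_group_add, 'm) vect_cat_scheme" (structure) +
  fixes B :: 'o
    and m :: "'v \<Rightarrow> 'v" and \<eta> :: "'v \<Rightarrow> 'v" and \<Delta> :: "'v \<Rightarrow> 'v" and \<epsilon> :: "'v \<Rightarrow> 'v" and S :: "'v \<Rightarrow> 'v"
  assumes mult_hom: "m \<in> hom C (B \<otimes> B) B"
    and unit_hom: "\<eta> \<in> hom C \<one> B"
    and comult_hom: "\<Delta> \<in> hom C B (B \<otimes> B)"
    and counit_hom: "\<epsilon> \<in> hom C B \<one>"
    and antipode_hom: "S \<in> hom C B B"
    and mult_assoc:
      "map_eq C ((B \<otimes> B) \<otimes> B)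
         (m \<circ> tmap C (B \<otimes> B) B B B m id) (m \<circ> tmap C B B (B \<otimes> B) B id m \<circ> assoc C B B B)"
    and mult_unit_left: "map_eq C (\<one> \<otimes> B) (m \<circ> tmap C \<one> B B B \<eta> id) (lunit C B)"
    and mult_unit_right: "map_eq C (B \<otimes> \<one>) (m \<circ> tmap C B B \<one> B id \<eta>) (runit C B)"
    and comult_coassoc:
      "map_eq C B
         (assoc C B B B \<circ> tmap C B (B \<otimes> B) B B \<Delta> id \<circ> \<Delta>) (tmap C B B B (B \<otimes> B) id \<Delta> \<circ> \<Delta>)"
    and counit_left: "map_eq C B (tmap C B \<one> B B \<epsilon> id \<circ> \<Delta>) (lunit_inv C B)"
    and counit_right: "map_eq C B (tmap C B B B \<one> id \<epsilon> \<circ> \<Delta>) (runit_inv C B)"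
    and comult_mult:
      "map_eq C (B \<otimes> B)
         (\<Delta> \<circ> m) (braided_tensor_mult C B m \<circ> tmap C B (B \<otimes> B) B (B \<otimes> B) \<Delta> \<Delta>)"
    and comult_unit: "map_eq C \<one> (\<Delta> \<circ> \<eta>) (tmap C \<one> B \<one> B \<eta> \<eta> \<circ> lunit_inv C \<one>)"
    and counit_mult: "map_eq C (B \<otimes> B) (\<epsilon> \<circ> m) (lunit C \<one> \<circ> tmap C B \<one> B \<one> \<epsilon> \<epsilon>)"
    and counit_unit: "map_eq C \<one> (\<epsilon> \<circ> \<eta>) id"
    and antipode_left: "map_eq C B (m \<circ> tmap C B B B B S id \<circ> \<Delta>) (\<eta> \<circ> \<epsilon>)"
    and antipode_right: "map_eq C B (m \<circ> tmap C B B B B id S \<circ> \<Delta>) (\<eta> \<circ> \<epsilon>)"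

definition is_dual ::
    "('o, 'v::ab_group_add, 'm) vect_cat_scheme \<Rightarrow> 'o \<Rightarrow> 'o \<Rightarrow> ('v \<Rightarrow> 'v) \<Rightarrow> ('v \<Rightarrow> 'v) \<Rightarrow> bool" where
  "is_dual C B Bd ev coev \<longleftrightarrow>
     ev \<in> hom C (Bd \<otimes>\<^bsub>C\<^esub> B) \<one>\<^bsub>C\<^esub> \<and>
     coev \<in> hom C \<one>\<^bsub>C\<^esub> (B \<otimes>\<^bsub>C\<^esub> Bd) \<and>
     map_eq C B
       (runit C B \<circ> tmap C B B (Bd \<otimes>\<^bsub>C\<^esub> B) \<one>\<^bsub>C\<^esub> id ev \<circ> assoc C B Bd B \<circ>
        tmap C \<one>\<^bsub>C\<^esub> (B \<otimes>\<^bsub>C\<^esub> Bd) B B coev id \<circ> lunit_inv C B) id \<and>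
     map_eq C Bd
       (lunit C Bd \<circ> tmap C (Bd \<otimes>\<^bsub>C\<^esub> B) \<one>\<^bsub>C\<^esub> Bd Bd ev id \<circ> assoc_inv C Bd B Bd \<circ>
        tmap C Bd Bd \<one>\<^bsub>C\<^esub> (B \<otimes>\<^bsub>C\<^esub> Bd) id coev \<circ> runit_inv C Bd) id"

text \<open>
  The braided trace \<open>ev \<circ> \<Psi> \<circ> (f \<otimes> id) \<circ> coev : \<one> \<rightarrow> \<one>\<close>, evaluated at 1. It is meant for an
  arbitrary linear endomorphism \<open>f\<close> of \<open>B\<close>, since left multiplications need not be morphisms of
  the category.
\<close>

definition braided_trace ::
    "('o, 'v::ab_group_add, 'm) vect_cat_scheme \<Rightarrow> 'o \<Rightarrow> 'o \<Rightarrow> ('v \<Rightarrow> 'v) \<Rightarrow> ('v \<Rightarrow> 'v) \<Rightarrow>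
     ('v \<Rightarrow> 'v) \<Rightarrow> 'v" where
  "braided_trace C B Bd ev coev f =
     (ev \<circ> braid C B Bd \<circ> tmap C B B Bd Bd f id \<circ> coev) (unit_vec C)"

definition left_mult ::
    "('o, 'v::ab_group_add, 'm) vect_cat_scheme \<Rightarrow> 'o \<Rightarrow> ('v \<Rightarrow> 'v) \<Rightarrow> 'v \<Rightarrow> 'v \<Rightarrow> 'v" where
  "left_mult C B m b x = m (pure C B B b x)"

definition braided_integral ::
    "('o, 'v::ab_group_add, 'm) vect_cat_scheme \<Rightarrow> 'o \<Rightarrow> 'o \<Rightarrow> ('v \<Rightarrow> 'v) \<Rightarrow> ('v \<Rightarrow> 'v) \<Rightarrow>
     ('v \<Rightarrow> 'v) \<Rightarrow> ('v \<Rightarrow> 'v) \<Rightarrow> 'v \<Rightarrow> 'v" where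
  "braided_integral C B Bd ev coev m S b =
     braided_trace C B Bd ev coev (left_mult C B m b \<circ> (S \<circ> S))"

context monoidal_vect_cat
begin

lemma subspace_UNIV: "module.subspace (scal C) UNIV"
  using vector_space_scal by (simp add: module.subspace_UNIV module_iff_vector_space)

lemma lift_spec:
  assumes "bilinear_map C (vspace C X) (vspace C Y) UNIV b"
  shows lift_linear: "linear_map C (vspace C (X \<otimes> Y)) UNIV (lift C X Y b)"
    and lift_pure:
      "\<lbrakk>x \<in> vspace C X; y \<in> vspace C Y\<rbrakk> \<Longrightarrow> lift C X Y b (pure C X Y x y) = b x y"
proof -
  let ?P = "\<lambda>h. linear_map C (vspace C (X \<otimes> Y)) UNIV h \<and>
     (\<forall>x\<in>vspace C X. \<forall>y\<in>vspace C Y. h (pure C X Y x y) = b x y)"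
  have "\<exists>h. ?P h" using tensor_universal[OF subspace_UNIV assms] by blast
  then have *: "?P (lift C X Y b)" unfolding lift_def by (rule someI_ex)
  show "linear_map C (vspace C (X \<otimes> Y)) UNIV (lift C X Y b)" using * by blast
  show "\<lbrakk>x \<in> vspace C X; y \<in> vspace C Y\<rbrakk> \<Longrightarrow> lift C X Y b (pure C X Y x y) = b x y"
    using * by blast
qed

lemma linear_map_UNIV: "linear_map C S T f \<Longrightarrow> linear_map C S UNIV f"
  by (simp add: linear_map_def)

lemma linear_map_comp: "linear_map C S T f \<Longrightarrow> linear_map C T U g \<Longrightarrow> linear_map C S U (\<lambda>x. g (f x))"
  by (simp add: linear_map_def)

lemma pure_in: "\<lbrakk>x \<in> vspace C X; y \<in> vspace C Y\<rbrakk> \<Longrightarrow> pure C X Y x y \<in> vspace C (X \<otimes> Y)"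
  using bilinear_pure[of X Y] by (auto simp: bilinear_map_def linear_map_def)

lemma pure_linear1: "x \<in> vspace C X \<Longrightarrow> linear_map C (vspace C Y) (vspace C (X \<otimes> Y)) (pure C X Y x)"
  using bilinear_pure[of X Y] by (auto simp: bilinear_map_def)

lemma pure_linear2:
  "y \<in> vspace C Y \<Longrightarrow> linear_map C (vspace C X) (vspace C (X \<otimes> Y)) (\<lambda>x. pure C X Y x y)"
  using bilinear_pure[of X Y] by (auto simp: bilinear_map_def)

lemma pure_bilinear_comp:
  assumes "linear_map C S (vspace C X) f" "linear_map C T (vspace C Y) g"
  shows "bilinear_map C S T (vspace C (X \<otimes> Y)) (\<lambda>x y. pure C X Y (f x) (g y))"
  unfolding bilinear_map_def
proof (intro conjI ballI)
  fix x assume "x \<in> S"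
  then have "f x \<in> vspace C X" using assms(1) by (simp add: linear_map_def)
  from linear_map_comp[OF assms(2) pure_linear1[OF this]]
  show "linear_map C T (vspace C (X \<otimes> Y)) (\<lambda>y. pure C X Y (f x) (g y))" .
next
  fix y assume "y \<in> T"
  then have "g y \<in> vspace C Y" using assms(2) by (simp add: linear_map_def)
  from linear_map_comp[OF assms(1) pure_linear2[OF this]]
  show "linear_map C S (vspace C (X \<otimes> Y)) (\<lambda>x. pure C X Y (f x) (g y))" .
qed

lemma bilinear_map_UNIV: "bilinear_map C S T W b \<Longrightarrow> bilinear_map C S T UNIV b"
  by (auto simp: bilinear_map_def intro: linear_map_UNIV)

lemma tensor_ext:
  assumes "linear_map C (vspace C (X \<otimes> Y)) UNIV f" "linear_map C (vspace C (X \<otimes> Y)) UNIV g"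
    and "\<And>x y. \<lbrakk>x \<in> vspace C X; y \<in> vspace C Y\<rbrakk> \<Longrightarrow> f (pure C X Y x y) = g (pure C X Y x y)"
    and "w \<in> vspace C (X \<otimes> Y)"
  shows "f w = g w"
proof -
  let ?b = "\<lambda>x y. g (pure C X Y x y)"
  have "bilinear_map C (vspace C X) (vspace C Y) UNIV ?b"
    using bilinear_pure[of X Y] assms(2)
    by (auto simp: bilinear_map_def intro: linear_map_comp)
  from tensor_universal[OF subspace_UNIV this] assms show ?thesis
    unfolding map_eq_def by metis
qed

lemma tmap_linear:
  assumes "linear_map C (vspace C X) (vspace C X') f" "linear_map C (vspace C Y) (vspace C Y') g"
  shows "linear_map C (vspace C (X \<otimes> Y)) UNIV (tmap C X X' Y Y' f g)"
  unfolding tmap_def by (rule lift_linear[OF bilinear_map_UNIV[OF pure_bilinear_comp[OF assms]]])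

lemma tmap_pure:
  assumes "linear_map C (vspace C X) (vspace C X') f" "linear_map C (vspace C Y) (vspace C Y') g"
    and "x \<in> vspace C X" "y \<in> vspace C Y"
  shows "tmap C X X' Y Y' f g (pure C X Y x y) = pure C X' Y' (f x) (g y)"
  unfolding tmap_def
  by (rule lift_pure[OF bilinear_map_UNIV[OF pure_bilinear_comp[OF assms(1,2)]] assms(3,4)])

lemma assoc_inv_pure:
  assumes x: "x \<in> vspace C X" and y: "y \<in> vspace C Y" and z: "z \<in> vspace C Z"
  shows "assoc_inv C X Y Z (pure C X (Y \<otimes> Z) x (pure C Y Z y z)) =
         pure C (X \<otimes> Y) Z (pure C X Y x y) z"
proof -
  let ?k = "\<lambda>x. lift C Y Z (\<lambda>y z. pure C (X \<otimes> Y) Z (pure C X Y x y) z)"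
  have idl: "linear_map C S S (\<lambda>z. z)" for S by (simp add: linear_map_def)
  have b: "bilinear_map C (vspace C Y) (vspace C Z) UNIV
             (\<lambda>y z. pure C (X \<otimes> Y) Z (pure C X Y x y) z)" if "x \<in> vspace C X" for x
    by (rule bilinear_map_UNIV[OF pure_bilinear_comp[OF pure_linear1[OF that] idl]])
  have l: "linear_map C (vspace C (Y \<otimes> Z)) UNIV (?k x)" if "x \<in> vspace C X" for x
    by (rule lift_linear[OF b[OF that]])
  have p: "?k x (pure C Y Z y z) = pure C (X \<otimes> Y) Z (pure C X Y x y) z"
    if "x \<in> vspace C X" "y \<in> vspace C Y" "z \<in> vspace C Z" for x y z
    by (rule lift_pure[OF b[OF that(1)] that(2,3)])
  interpret vector_space "scal C" by (rule vector_space_scal)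
  have tri: "linear_map C (vspace C X) UNIV (\<lambda>x. pure C (X \<otimes> Y) Z (pure C X Y x y) z)"
    if "y \<in> vspace C Y" "z \<in> vspace C Z" for y z
    using linear_map_UNIV[OF linear_map_comp[OF pure_linear2[OF that(1), of X]
        pure_linear2[OF that(2), of "X \<otimes> Y"]]] .
  have r: "linear_map C (vspace C X) UNIV (\<lambda>x. ?k x w)" if w: "w \<in> vspace C (Y \<otimes> Z)" for w
    unfolding linear_map_def
  proof (intro conjI ballI allI)
    fix x x' assume x: "x \<in> vspace C X" and x': "x' \<in> vspace C X"
    have s: "x + x' \<in> vspace C X" using subspace_space x x' by (rule subspace_add)
    show "?k (x + x') w = ?k x w + ?k x' w"
    proof (rule tensor_ext[OF l[OF s] _ _ w])
      show "linear_map C (vspace C (Y \<otimes> Z)) UNIV (\<lambda>w. ?k x w + ?k x' w)"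
        using l[OF x] l[OF x'] by (simp add: linear_map_def scale_right_distrib algebra_simps)
    next
      fix y z assume "y \<in> vspace C Y" "z \<in> vspace C Z"
      then show "?k (x + x') (pure C Y Z y z) = ?k x (pure C Y Z y z) + ?k x' (pure C Y Z y z)"
        using tri[of y z] x x' by (simp only: p s) (simp add: linear_map_def)
    qed
  next
    fix c x assume x: "x \<in> vspace C X"
    have s: "scal C c x \<in> vspace C X" using subspace_space x by (rule subspace_scale)
    show "?k (scal C c x) w = scal C c (?k x w)"
    proof (rule tensor_ext[OF l[OF s] _ _ w])
      show "linear_map C (vspace C (Y \<otimes> Z)) UNIV (\<lambda>w. scal C c (?k x w))"
        using l[OF x] by (simp add: linear_map_def scale_right_distrib mult.commute)
    next
      fix y z assume "y \<in> vspace C Y" "z \<in> vspace C Z"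
      then show "?k (scal C c x) (pure C Y Z y z) = scal C c (?k x (pure C Y Z y z))"
        using tri[of y z] x by (simp only: p s) (simp add: linear_map_def)
    qed
  qed simp
  have "bilinear_map C (vspace C X) (vspace C (Y \<otimes> Z)) UNIV ?k"
    using l r by (simp add: bilinear_map_def)
  from lift_pure[OF this x pure_in[OF y z]] show ?thesis
    unfolding assoc_inv_def by (simp only: p[OF x y z])
qed

end

text \<open>The integral as a composite of morphisms.\<close>

lemma (in braided_group) braided_integral_composite:
  assumes "is_dual C B Bd ev coev"
  shows "map_eq C B (braided_integral C B Bd ev coev m S)
    (ev \<circ> braid C B Bd \<circ> tmap C (B \<otimes> B) B Bd Bd m id \<circ> assoc_inv C B B Bd \<circ>
     tmap C B B (B \<otimes> Bd) (B \<otimes> Bd) id (tmap C B B Bd Bd (S \<circ> S) id) \<circ>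
     tmap C B B \<one> (B \<otimes> Bd) id coev \<circ> runit_inv C B)"
  unfolding map_eq_def
proof
  fix b assume b: "b \<in> vspace C B"
  let ?w = "coev (unit_vec C)"
  let ?L = "left_mult C B m b \<circ> (S \<circ> S)"
  interpret vector_space "scal C" by (rule vector_space_scal)
  note lin = hom_linear[OF id_hom] hom_linear[OF mult_hom]
    hom_linear[OF comp_hom[OF antipode_hom antipode_hom]]
  have u: "unit_vec C \<in> vspace C \<one>"
    unfolding space_unit by (rule range_eqI[of _ _ 1]) (simp add: scale_one)
  have coev: "linear_map C (vspace C \<one>) (vspace C (B \<otimes> Bd)) coev"
    using assms hom_linear by (simp add: is_dual_def)
  have w: "?w \<in> vspace C (B \<otimes> Bd)" using coev u by (simp add: linear_map_def)
  let ?T = "tmap C B B Bd Bd (S \<circ> S) id"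
  have T: "linear_map C (vspace C (B \<otimes> Bd)) (vspace C (B \<otimes> Bd)) ?T"
    by (rule hom_linear[OF tmap_hom[OF comp_hom[OF antipode_hom antipode_hom] id_hom]])
  have Lm: "linear_map C (vspace C B) (vspace C B) (left_mult C B m b)"
    using linear_map_comp[OF pure_linear1[OF b] lin(2)] by (simp add: left_mult_def[abs_def])
  have L: "linear_map C (vspace C B) (vspace C B) ?L"
    using linear_map_comp[OF lin(3) Lm] by (simp add: comp_def)
  let ?F = "\<lambda>w. tmap C (B \<otimes> B) B Bd Bd m id (assoc_inv C B B Bd (pure C B (B \<otimes> Bd) b (?T w)))"
  have F: "linear_map C (vspace C (B \<otimes> Bd)) UNIV ?F"
    by (rule linear_map_UNIV[OF linear_map_comp[OF linear_map_comp[OF linear_map_comp[OF T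
          pure_linear1[OF b]] hom_linear[OF assoc_inv_hom]]
          hom_linear[OF tmap_hom[OF mult_hom id_hom]]]])
  have "?F ?w = tmap C B B Bd Bd ?L id ?w"
  proof (rule tensor_ext[OF F tmap_linear[OF L lin(1)] _ w])
    fix x y assume x: "x \<in> vspace C B" and y: "y \<in> vspace C Bd"
    have Sx: "(S \<circ> S) x \<in> vspace C B" using lin(3) x unfolding linear_map_def by blast
    show "?F (pure C B Bd x y) = tmap C B B Bd Bd ?L id (pure C B Bd x y)"
      using tmap_pure[OF lin(3) lin(1) x y] tmap_pure[OF L lin(1) x y]
        assoc_inv_pure[OF b Sx y] tmap_pure[OF lin(2) lin(1) pure_in[OF b Sx] y]
      by (simp add: left_mult_def)
  qed
  moreover have "tmap C B B \<one> (B \<otimes> Bd) id coev (pure C B \<one> b (unit_vec C)) = pure C B (B \<otimes> Bd) b ?w"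
    using tmap_pure[OF lin(1) coev b u] by simp
  moreover have "tmap C B B (B \<otimes> Bd) (B \<otimes> Bd) id ?T (pure C B (B \<otimes> Bd) b ?w) =
      pure C B (B \<otimes> Bd) b (?T ?w)"
    using tmap_pure[OF lin(1) T b w] by simp
  ultimately show "braided_integral C B Bd ev coev m S b =
    (ev \<circ> braid C B Bd \<circ> tmap C (B \<otimes> B) B Bd Bd m id \<circ> assoc_inv C B B Bd \<circ>
     tmap C B B (B \<otimes> Bd) (B \<otimes> Bd) id ?T \<circ> tmap C B B \<one> (B \<otimes> Bd) id coev \<circ> runit_inv C B) b"
    by (simp add: braided_integral_def braided_trace_def runit_inv_def)
qed

end

theory Submission
  imports Defs
begin

text \<open>The braidings that the overview suppresses are where the work lies, and associators and
  unitors would swamp a direct calculation. The identities are therefore derived on formal string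
  diagrams, where each step is checked by evaluation. There is no generator for the inverse
  braiding: every step uses naturality of the one crossing \<Psi>. Turning diagrams upside down
  yields \<open>\<Delta> S = (S \<otimes> S) \<Psi> \<Delta>\<close> from the corresponding rule for
  products.

  The map \<open>x \<mapsto> S(x\<^sub>1) \<otimes> x\<^sub>2\<close> has an additional output, so
  it is not an endomorphism that cyclicity of a trace could move. Instead a snake is inserted, which
  turns the map into a transpose on the dual strand; the strand that closes the trace is then pulled
  across it.

  To interpret diagrams without coherence bookkeeping, a map \<open>F\<close> is replaced by the
  family of all \<open>F \<otimes> id\<close> on right-nested products with an open right end
  \<open>Z\<close>. A context on the right is then absorbed in \<open>Z\<close>, and interchange is
  naturality in \<open>Z\<close>. The axioms enter and the theorem leaves this setting because
  \<open>F\<close> determines the family, and the family determines \<open>F\<close> when the target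
  is a single object.\<close>

text \<open>
  Write \<open>x\<^sub>1 \<otimes> x\<^sub>2\<close> for \<open>\<Delta> x\<close> and suppress the braidings. Then
  \<open>b\<^sub>1 \<otimes> b\<^sub>2 S\<^sup>2(x) = y\<^sub>1 S(x\<^sub>1) \<otimes> y\<^sub>2\<close> with \<open>y = b S\<^sup>2(x\<^sub>2)\<close>. The partial trace over \<open>x\<close> of the left
  side is \<open>(id \<otimes> \<integral>)\<Delta>(b)\<close>. In the right side the map \<open>x \<mapsto> S(x\<^sub>1) \<otimes> x\<^sub>2\<close> can be slid around the trace,
  so that it is applied to \<open>y\<^sub>2\<close> and gives \<open>y\<^sub>1 S(y\<^sub>2) \<otimes> y\<^sub>3 = 1 \<otimes> y\<close>, that is \<open>1 \<integral> b\<close>.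
  The braidings match because \<open>\<Delta> \<circ> S\<^sup>2 = \<Psi>\<^sup>2 \<circ> (S\<^sup>2 \<otimes> S\<^sup>2) \<circ> \<Delta>\<close>.
\<close>

section \<open>String diagrams\<close>

datatype strand = Alg | Dual

datatype gen =
  Mult | Unit | Comult | Counit | Antip | Cross | CrossD | Ev | Coev

text \<open>
  The layer \<open>(i, g)\<close> applies the generator \<open>g\<close> to the strands starting at position \<open>i\<close>, counted
  from 0, and the identity to all others; a diagram is read from its first layer on.
\<close>

type_synonym word = "strand list"
type_synonym diagram = "(nat \<times> gen) list"

fun src :: "gen \<Rightarrow> word" where
  "src Mult = [Alg, Alg]"
| "src Unit = []"
| "src Comult = [Alg]"
| "src Counit = [Alg]"
| "src Antip = [Alg]"
| "src Cross = [Alg, Alg]"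
| "src CrossD = [Alg, Dual]"
| "src Ev = [Dual, Alg]"
| "src Coev = []"

fun tgt :: "gen \<Rightarrow> word" where
  "tgt Mult = [Alg]"
| "tgt Unit = [Alg]"
| "tgt Comult = [Alg, Alg]"
| "tgt Counit = []"
| "tgt Antip = [Alg]"
| "tgt Cross = [Alg, Alg]"
| "tgt CrossD = [Dual, Alg]"
| "tgt Ev = []"
| "tgt Coev = [Alg, Dual]"

fun run :: "word \<Rightarrow> diagram \<Rightarrow> word option" where
  "run w [] = Some w"
| "run w ((i, g) # D) =
     (if i \<le> length w \<and> take (length (src g)) (drop i w) = src g
      then run (take i w @ tgt g @ drop (i + length (src g)) w) D else None)"

definition shift :: "nat \<Rightarrow> diagram \<Rightarrow> diagram" where
  "shift k D = map (\<lambda>(i, g). (k + i, g)) D"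

section \<open>Typed diagrams and the congruence generated by rules\<close>

lemma run_layer_iff:
  "run w ((i, g) # D) = Some w' \<longleftrightarrow>
     (\<exists>a b. w = a @ src g @ b \<and> length a = i \<and> run (a @ tgt g @ b) D = Some w')"
proof
  assume r: "run w ((i, g) # D) = Some w'"
  then have i: "i \<le> length w" "take (length (src g)) (drop i w) = src g"
    by (auto split: if_splits)
  then have "w = take i w @ src g @ drop (i + length (src g)) w"
    by (metis append_take_drop_id drop_drop add.commute)
  with r i show "\<exists>a b. w = a @ src g @ b \<and> length a = i \<and> run (a @ tgt g @ b) D = Some w'"
    by (intro exI[of _ "take i w"] exI[of _ "drop (i + length (src g)) w"]) (auto split: if_splits)
qed auto

lemma run_layer [simp]: "run (a @ src g @ b) ((length a, g) # D) = run (a @ tgt g @ b) D"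
  by simp

declare run.simps(2) [simp del]

lemma run_append: "run w (D @ E) = (case run w D of None \<Rightarrow> None | Some v \<Rightarrow> run v E)"
  by (induction D arbitrary: w) (auto simp: run.simps(2))

lemma run_shift: "run u D = Some v \<Longrightarrow> run (a @ u @ b) (shift (length a) D) = Some (a @ v @ b)"
proof (induction D arbitrary: u)
  case (Cons l D)
  obtain i g where l: "l = (i, g)" by fastforce
  from Cons.prems l obtain p q where u: "u = p @ src g @ q" "length p = i"
    "run (p @ tgt g @ q) D = Some v" by (auto simp: run_layer_iff)
  from Cons.IH[OF u(3)] have "run ((a @ p) @ tgt g @ q @ b) (shift (length a) D) = Some (a @ v @ b)"
    by simp
  moreover have "a @ u @ b = (a @ p) @ src g @ (q @ b)" using u by simp
  moreover have "shift (length a) (l # D) = (length (a @ p), g) # shift (length a) D"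
    using l u by (simp add: shift_def)
  ultimately show ?case by (metis run_layer append_assoc)
qed (simp add: shift_def)

text \<open>The smallest congruence on typed diagrams that contains \<open>R\<close>. Only
  interchange is built in; naturality of the crossing has to come from \<open>R\<close>. In
  \<open>deriv_interchange\<close> the position of \<open>h\<close> depends on whether
  \<open>g\<close> has already replaced its inputs by its outputs.\<close>

inductive deriv ::
    "(word \<Rightarrow> diagram \<Rightarrow> diagram \<Rightarrow> bool) \<Rightarrow> word \<Rightarrow> diagram \<Rightarrow> diagram \<Rightarrow> bool" for R where
  deriv_rule: "\<lbrakk>R u l r; run u l = Some v; run u r = Some v\<rbrakk> \<Longrightarrow> deriv R u l r"
| deriv_interchange:
    "deriv R (a @ src g @ b @ src h @ c)
       [(length a, g), (length a + length (tgt g) + length b, h)]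
       [(length a + length (src g) + length b, h), (length a, g)]"
| deriv_refl: "run w D = Some v \<Longrightarrow> deriv R w D D"
| deriv_sym: "deriv R w D E \<Longrightarrow> deriv R w E D"
| deriv_trans [trans]: "\<lbrakk>deriv R w D E; deriv R w E F\<rbrakk> \<Longrightarrow> deriv R w D F"
| deriv_whisker: "deriv R u D E \<Longrightarrow> deriv R (a @ u @ b) (shift (length a) D) (shift (length a) E)"
| deriv_append:
    "\<lbrakk>deriv R u D D'; run u D = Some v; deriv R v E E'\<rbrakk> \<Longrightarrow> deriv R u (D @ E) (D' @ E')"

lemma run_interchange:
  "run (a @ src g @ b @ src h @ c)
     [(length a, g), (length a + length (tgt g) + length b, h)] = Some (a @ tgt g @ b @ tgt h @ c)"
  "run (a @ src g @ b @ src h @ c)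
     [(length a + length (src g) + length b, h), (length a, g)] = Some (a @ tgt g @ b @ tgt h @ c)"
  using run_layer[of "a @ tgt g @ b" h c "[]"] run_layer[of "a @ src g @ b" h c "[(length a, g)]"]
  by (simp_all add: add.assoc)

lemma deriv_run: "deriv R w D E \<Longrightarrow> \<exists>v. run w D = Some v \<and> run w E = Some v"
proof (induction rule: deriv.induct)
  case (deriv_interchange a g b h c)
  then show ?case using run_interchange by blast
qed (auto simp: run_append dest: run_shift)

lemma deriv_mono:
  assumes "\<And>u l r. R u l r \<Longrightarrow> R' u l r" "deriv R w D E"
  shows "deriv R' w D E"
  using assms(2) by induction (auto intro: deriv.intros assms(1))

text \<open>Diagrams that differ by interchanges of distant layers are compared through a normal form.\<close>

fun insert_layer :: "nat \<times> gen \<Rightarrow> diagram \<Rightarrow> diagram" where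
  "insert_layer l [] = [l]"
| "insert_layer (i, g) ((j, h) # D) =
     (if i + length (tgt g) \<le> j
      then (j + length (src g) - length (tgt g), h) # insert_layer (i, g) D
      else (i, g) # (j, h) # D)"

definition normal_form :: "diagram \<Rightarrow> diagram" where
  "normal_form D = foldr insert_layer D []"

lemma deriv_Cons:
  assumes "run w [l] = Some v" "deriv R v D E"
  shows "deriv R w (l # D) (l # E)"
  using deriv_append[OF deriv_refl[OF assms(1)] assms] by simp

lemma deriv_insert_layer: "run w (l # D) = Some v \<Longrightarrow> deriv R w (l # D) (insert_layer l D)"
proof (induction l D arbitrary: w rule: insert_layer.induct)
  case (2 i g j h D)
  show ?case
  proof (cases "i + length (tgt g) \<le> j")
    case True
    from 2(2) obtain a b where w: "w = a @ src g @ b" "length a = i"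
      and r: "run (a @ tgt g @ b) ((j, h) # D) = Some v" by (auto simp: run_layer_iff)
    from r obtain p q where p: "a @ tgt g @ b = p @ src h @ q" "length p = j"
      "run (p @ tgt h @ q) D = Some v" by (auto simp: run_layer_iff)
    \<comment> \<open>Since \<open>h\<close> starts at or after the end of the outputs of
      \<open>g\<close>, the prefix \<open>p\<close> contains \<open>a @ tgt g\<close>, and the
      inputs of \<open>h\<close> lie inside \<open>b\<close>.\<close>
    have "p = take j ((a @ tgt g) @ b)" using p by simp
    also have "\<dots> = (a @ tgt g) @ take (j - i - length (tgt g)) b"
      using True w by (simp only: take_append) simp
    finally obtain b' where p': "p = a @ tgt g @ b'" by simp
    with p(1) have b: "b = b' @ src h @ q" by simp
    have j: "j = length a + length (tgt g) + length b'"
      "j + length (src g) - length (tgt g) = length a + length (src g) + length b'"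
      using p(2) p' by auto
    have s: "deriv R w [(i, g), (j, h)] [(j + length (src g) - length (tgt g), h), (i, g)]"
      unfolding w(1) b j w(2)[symmetric] j(2)[unfolded j(1)] by (rule deriv_interchange)
    have rs: "run w [(i, g), (j, h)] = Some (p @ tgt h @ q)"
      unfolding w(1) b j w(2)[symmetric] p' using run_interchange(1) by simp
    have "deriv R w ([(i, g), (j, h)] @ D) ([(j + length (src g) - length (tgt g), h), (i, g)] @ D)"
      by (rule deriv_append[OF s rs deriv_refl[OF p(3)]])
    also have "[(j + length (src g) - length (tgt g), h), (i, g)] @ D =
        (j + length (src g) - length (tgt g), h) # (i, g) # D" by simp
    also have "deriv R w ((j + length (src g) - length (tgt g), h) # (i, g) # D)
        ((j + length (src g) - length (tgt g), h) # insert_layer (i, g) D)"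
    proof (rule deriv_Cons)
      show "run w [(j + length (src g) - length (tgt g), h)] = Some (a @ src g @ b' @ tgt h @ q)"
        unfolding w(1) b j(2) using run_layer[of "a @ src g @ b'" h q "[]"] by (simp add: add.assoc)
      show "deriv R (a @ src g @ b' @ tgt h @ q) ((i, g) # D) (insert_layer (i, g) D)"
        using run_layer[of a g "b' @ tgt h @ q" D] p(3) w(2) True
        by (intro 2(1)) (simp_all add: p')
    qed
    finally show ?thesis using True by simp
  qed (use 2 in \<open>auto intro: deriv_refl\<close>)
qed (auto intro: deriv_refl)

lemma deriv_normal_form: "run w D = Some v \<Longrightarrow> deriv R w D (normal_form D)"
proof (induction D arbitrary: w)
  case (Cons l D)
  obtain x where l: "run w [l] = Some x" and x: "run x D = Some v"
    using Cons.prems run_append[of w "[l]" D] by (auto split: option.splits)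
  have d: "deriv R w (l # D) (l # normal_form D)"
    by (rule deriv_Cons[OF l Cons.IH[OF x]])
  from deriv_run[OF d] obtain y where "run w (l # normal_form D) = Some y" by blast
  from deriv_trans[OF d deriv_insert_layer[OF this]] show ?case
    by (simp add: normal_form_def)
qed (auto simp: normal_form_def intro: deriv_refl)

lemma deriv_interchanges:
  assumes "normal_form D = normal_form E" "run w D \<noteq> None" "run w E \<noteq> None"
  shows "deriv R w D E"
  using assms deriv_normal_form by (metis deriv_sym deriv_trans not_None_eq)

text \<open>
  \<open>rewrite_step u l r n k w D E\<close> decides whether replacing \<open>l\<close> by \<open>r\<close> in \<open>D\<close>, from the \<open>n\<close>-th layer and
  the \<open>k\<close>-th strand on, yields \<open>E\<close> up to interchanges.
\<close>

definition rewrite_step ::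
    "word \<Rightarrow> diagram \<Rightarrow> diagram \<Rightarrow> nat \<Rightarrow> nat \<Rightarrow> word \<Rightarrow> diagram \<Rightarrow> diagram \<Rightarrow> bool" where
  "rewrite_step u l r n k w D E \<longleftrightarrow>
     (case run w (take n D) of None \<Rightarrow> False | Some v \<Rightarrow>
        k \<le> length v \<and> take (length u) (drop k v) = u) \<and>
     take (length l) (drop n D) = shift k l \<and> run w D \<noteq> None \<and> run w E \<noteq> None \<and>
     normal_form (take n D @ shift k r @ drop (n + length l) D) = normal_form E"

text \<open>For concrete diagrams the second premise is a closed computation, left to
  \<open>code_simp\<close>. The redex must occupy consecutive layers of \<open>D\<close>, but the
  result is compared only up to interchange; hence each line of a calculation can be written in the
  order that its next step requires.\<close>

lemma deriv_rewrite:
  assumes lr: "deriv R u l r" and rw: "rewrite_step u l r n k w D E"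
  shows "deriv R w D E"
proof -
  obtain v where v: "run w (take n D) = Some v" "k \<le> length v" "take (length u) (drop k v) = u"
    using rw by (auto simp: rewrite_step_def split: option.splits)
  have ve: "v = take k v @ u @ drop (k + length u) v"
    using v(3) by (metis append_take_drop_id drop_drop add.commute)
  have D: "D = take n D @ shift k l @ drop (n + length l) D"
    using rw unfolding rewrite_step_def by (metis append_take_drop_id drop_drop add.commute)
  let ?q = "drop (n + length l) D"
  have d: "deriv R v (shift k l) (shift k r)"
    using deriv_whisker[OF lr, of "take k v" "drop (k + length u) v"] ve v(2) by simp
  then obtain x where x: "run v (shift k l) = Some x" using deriv_run by blast
  have "run w D \<noteq> None" using rw by (simp add: rewrite_step_def)
  then obtain y where y: "run x ?q = Some y"
    using v(1) x by (subst (asm) D) (auto simp: run_append)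
  have "deriv R w D (take n D @ shift k r @ ?q)"
    by (subst D) (rule deriv_append[OF deriv_refl[OF v(1)] v(1) deriv_append[OF d x deriv_refl[OF y]]])
  moreover from deriv_run[OF this] have "deriv R w (take n D @ shift k r @ ?q) E"
    using rw by (intro deriv_interchanges) (auto simp: rewrite_step_def)
  ultimately show ?thesis by (rule deriv_trans)
qed

subsection \<open>Vertical reflection\<close>

text \<open>For \<open>CrossD\<close>, \<open>Ev\<close> and \<open>Coev\<close> the default value
  has the wrong type, as their reflections are not generators; \<open>hopf_diagram\<close> excludes
  them.\<close>

fun dual_gen :: "gen \<Rightarrow> gen" where
  "dual_gen Mult = Comult"
| "dual_gen Comult = Mult"
| "dual_gen Unit = Counit"
| "dual_gen Counit = Unit"
| "dual_gen g = g"

lemma dual_gen [simp]: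
  assumes "g \<notin> {CrossD, Ev, Coev}"
  shows "src (dual_gen g) = tgt g" "tgt (dual_gen g) = src g"
  using assms by (cases g; simp)+

text \<open>Positions are kept, because the inputs and the outputs of a layer start at the same
  strand.\<close>

definition dual :: "diagram \<Rightarrow> diagram" where
  "dual D = rev (map (\<lambda>(i, g). (i, dual_gen g)) D)"

definition hopf_diagram :: "diagram \<Rightarrow> bool" where
  "hopf_diagram D \<longleftrightarrow> snd ` set D \<inter> {CrossD, Ev, Coev} = {}"

text \<open>The crossing rules express naturality of \<Psi>, with the hexagons resolving a crossing
  with two strands into two crossings. The list is closed under \<open>dual\<close> up to
  interchange; \<open>deriv_dual\<close> rests on this.\<close>

inductive hopf_rule :: "word \<Rightarrow> diagram \<Rightarrow> diagram \<Rightarrow> bool" where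
  assoc_rule: "hopf_rule [Alg, Alg, Alg] [(0, Mult), (0, Mult)] [(1, Mult), (0, Mult)]"
| unit_left_rule: "hopf_rule [Alg] [(0, Unit), (0, Mult)] []"
| unit_right_rule: "hopf_rule [Alg] [(1, Unit), (0, Mult)] []"
| coassoc_rule: "hopf_rule [Alg] [(0, Comult), (0, Comult)] [(0, Comult), (1, Comult)]"
| counit_left_rule: "hopf_rule [Alg] [(0, Comult), (0, Counit)] []"
| counit_right_rule: "hopf_rule [Alg] [(0, Comult), (1, Counit)] []"
| comult_mult_rule:
    "hopf_rule [Alg, Alg] [(0, Mult), (0, Comult)]
       [(0, Comult), (2, Comult), (1, Cross), (0, Mult), (1, Mult)]"
| comult_unit_rule: "hopf_rule [] [(0, Unit), (0, Comult)] [(0, Unit), (0, Unit)]"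
| counit_mult_rule: "hopf_rule [Alg, Alg] [(0, Mult), (0, Counit)] [(0, Counit), (0, Counit)]"
| counit_unit_rule: "hopf_rule [] [(0, Unit), (0, Counit)] []"
| antip_left_rule:
    "hopf_rule [Alg] [(0, Comult), (0, Antip), (0, Mult)] [(0, Counit), (0, Unit)]"
| antip_right_rule:
    "hopf_rule [Alg] [(0, Comult), (1, Antip), (0, Mult)] [(0, Counit), (0, Unit)]"
| cross_mult_right_rule:
    "hopf_rule [Alg, Alg, Alg] [(1, Mult), (0, Cross)] [(0, Cross), (1, Cross), (0, Mult)]"
| cross_mult_left_rule:
    "hopf_rule [Alg, Alg, Alg] [(0, Mult), (0, Cross)] [(1, Cross), (0, Cross), (1, Mult)]"
| cross_comult_right_rule:
    "hopf_rule [Alg, Alg] [(1, Comult), (0, Cross), (1, Cross)] [(0, Cross), (0, Comult)]"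
| cross_comult_left_rule:
    "hopf_rule [Alg, Alg] [(0, Comult), (1, Cross), (0, Cross)] [(0, Cross), (1, Comult)]"
| cross_unit_right_rule: "hopf_rule [Alg] [(1, Unit), (0, Cross)] [(0, Unit)]"
| cross_unit_left_rule: "hopf_rule [Alg] [(0, Unit), (0, Cross)] [(1, Unit)]"
| cross_counit_right_rule: "hopf_rule [Alg, Alg] [(0, Cross), (0, Counit)] [(1, Counit)]"
| cross_counit_left_rule: "hopf_rule [Alg, Alg] [(0, Cross), (1, Counit)] [(0, Counit)]"
| cross_antip_right_rule: "hopf_rule [Alg, Alg] [(1, Antip), (0, Cross)] [(0, Cross), (0, Antip)]"
| cross_antip_left_rule: "hopf_rule [Alg, Alg] [(0, Antip), (0, Cross)] [(0, Cross), (1, Antip)]"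
| cross_cross_rule:
    "hopf_rule [Alg, Alg, Alg] [(0, Cross), (1, Cross), (0, Cross)]
       [(1, Cross), (0, Cross), (1, Cross)]"

lemma hopf_rule_run: "hopf_rule u l r \<Longrightarrow> \<exists>v. run u l = Some v \<and> run u r = Some v"
  by (induction rule: hopf_rule.induct) (simp_all add: run.simps)

lemma deriv_hopf_rule: "hopf_rule u l r \<Longrightarrow> deriv hopf_rule u l r"
  using hopf_rule_run by (blast intro: deriv_rule)

lemma run_dual:
  "\<lbrakk>hopf_diagram D; run w D = Some v\<rbrakk> \<Longrightarrow> run v (dual D) = Some w"
proof (induction D arbitrary: w)
  case (Cons l D)
  obtain i g where l: "l = (i, g)" by fastforce
  with Cons.prems obtain a b where w: "w = a @ src g @ b" "length a = i"
    and r: "run (a @ tgt g @ b) D = Some v" by (auto simp: run_layer_iff)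
  have g: "g \<notin> {CrossD, Ev, Coev}" and D: "hopf_diagram D"
    using Cons.prems l by (auto simp: hopf_diagram_def)
  have "run (a @ tgt g @ b) [(length a, dual_gen g)] = Some (a @ src g @ b)"
    using run_layer[of a "dual_gen g" b "[]"] g by (simp del: run_layer)
  with Cons.IH[OF D r] show ?case using l w by (simp add: dual_def run_append)
qed (simp add: dual_def)

lemma hopf_diagram_append [simp]:
  "hopf_diagram (D @ E) \<longleftrightarrow> hopf_diagram D \<and> hopf_diagram E"
  by (auto simp: hopf_diagram_def)

lemma hopf_diagram_shift [simp]: "hopf_diagram (shift k D) = hopf_diagram D"
  by (simp add: hopf_diagram_def shift_def image_image case_prod_beta)

lemma dual_append: "dual (D @ E) = dual E @ dual D"
  by (simp add: dual_def)

lemma dual_shift: "dual (shift k D) = shift k (dual D)"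
  by (auto simp: dual_def shift_def rev_map)

lemma deriv_hopf_rule_dual:
  assumes "hopf_rule u l r" "run u l = Some v"
  shows "hopf_diagram l \<and> hopf_diagram r \<and> deriv hopf_rule v (dual l) (dual r)"
  using assms
proof cases
  case comult_mult_rule
  \<comment> \<open>Reflection reverses the order of the two coproducts and of the two products, so
    this axiom is its own reflection only up to interchange.\<close>
  have "deriv hopf_rule [Alg, Alg] [(0, Mult), (0, Comult)]
          [(1, Comult), (0, Comult), (1, Cross), (2, Mult), (0, Mult)]"
    by (rule deriv_rewrite[OF deriv_hopf_rule[OF hopf_rule.comult_mult_rule], where n = 0 and k = 0])
      code_simp
  then show ?thesis using assms(2) comult_mult_rule
    by (simp add: run.simps hopf_diagram_def dual_def)
qed (use assms(2) in \<open>auto simp: run.simps hopf_diagram_def dual_def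
  intro: deriv_hopf_rule deriv_sym[OF deriv_hopf_rule] hopf_rule.intros[unfolded One_nat_def]\<close>)

lemma deriv_dual:
  assumes "deriv hopf_rule w D E" "hopf_diagram D" "run w D = Some v"
  shows "deriv hopf_rule v (dual D) (dual E)"
proof -
  \<comment> \<open>The first conjunct is carried along because transitivity and symmetry need
    \<open>hopf_diagram\<close> for diagrams other than the given \<open>D\<close>.\<close>
  have "hopf_diagram D = hopf_diagram E \<and>
      (hopf_diagram D \<longrightarrow> (\<forall>v. run w D = Some v \<longrightarrow> deriv hopf_rule v (dual D) (dual E)))"
    using assms(1)
  proof induction
    case (deriv_rule u l r v)
    then show ?case using deriv_hopf_rule_dual by blast
  next
    case (deriv_interchange a g b h c)
    show ?case
    proof (intro conjI impI allI)
      fix v assume h: "hopf_diagram [(length a, g), (length a + length (tgt g) + length b, h)]"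
        and "run (a @ src g @ b @ src h @ c)
          [(length a, g), (length a + length (tgt g) + length b, h)] = Some v"
      then have v: "v = a @ tgt g @ b @ tgt h @ c" by (simp only: run_interchange option.inject)
      have g: "g \<notin> {CrossD, Ev, Coev}" "h \<notin> {CrossD, Ev, Coev}"
        using h by (auto simp: hopf_diagram_def)
      show "deriv hopf_rule v (dual [(length a, g), (length a + length (tgt g) + length b, h)])
         (dual [(length a + length (src g) + length b, h), (length a, g)])"
        using deriv_sym[OF deriv.deriv_interchange[of hopf_rule a "dual_gen g" b "dual_gen h" c]] g
        unfolding v by (simp add: dual_def del: dual_gen.simps)
    qed (auto simp: hopf_diagram_def)
  next
    case (deriv_refl w D v)
    then show ?case using run_dual deriv.deriv_refl by metis
  next
    case (deriv_sym w D E)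
    then show ?case using deriv_run deriv.deriv_sym by metis
  next
    case (deriv_trans w D E F)
    then show ?case using deriv_run[OF deriv_trans.hyps(1)] deriv.deriv_trans by (metis option.inject)
  next
    case (deriv_whisker u D E a b)
    from deriv_run[OF deriv_whisker.hyps] obtain x where "run u D = Some x" by blast
    with deriv_whisker show ?case
      using run_shift[of u D x a b] deriv.deriv_whisker by (auto simp: dual_shift)
  next
    case (deriv_append u D D' v E E')
    from deriv_run[OF deriv_append.hyps(3)] obtain x where x: "run v E = Some x" "run v E' = Some x"
      by blast
    show ?case
    proof (intro conjI impI allI)
      fix y assume "hopf_diagram (D @ E)" "run u (D @ E) = Some y"
      then show "deriv hopf_rule y (dual (D @ E)) (dual (D' @ E'))"
        using deriv_append x run_dual[of E v x] deriv.deriv_append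
        by (simp add: dual_append run_append)
    qed (use deriv_append in auto)
  qed
  with assms show ?thesis by blast
qed

declare deriv_sym [sym]

lemmas hopf_rewrite = deriv_rewrite[OF deriv_hopf_rule]
lemmas hopf_rewrite_back = deriv_rewrite[OF deriv_hopf_rule[THEN deriv_sym]]

subsection \<open>The antipode\<close>

text \<open>As \<open>\<Delta>(1) = 1 \<otimes> 1\<close>,
  \<open>S(1) = S(1) 1 = S(1\<^sub>1) 1\<^sub>2 = \<epsilon>(1) 1 = 1\<close>.\<close>

lemma antip_unit:
  "deriv hopf_rule [] [(0, Unit), (0, Antip)]
     [(0, Unit)]"
proof -
  let ?d = "deriv hopf_rule []"
  have "?d [(0, Unit), (0, Antip)]
     [(0, Unit), (0, Unit), (0, Antip), (0, Mult)]"
    by (rule hopf_rewrite_back[OF unit_right_rule, where n = 2 and k = 0]) code_simp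
  also have "?d \<dots> [(0, Unit), (0, Comult), (0, Antip), (0, Mult)]"
    by (rule hopf_rewrite_back[OF comult_unit_rule, where n = 0 and k = 0]) code_simp
  also have "?d \<dots> [(0, Unit), (0, Counit), (0, Unit)]"
    by (rule hopf_rewrite[OF antip_left_rule, where n = 1 and k = 0]) code_simp
  also have "?d \<dots> [(0, Unit)]"
    by (rule hopf_rewrite[OF counit_unit_rule, where n = 0 and k = 0]) code_simp
  finally show ?thesis .
qed

text \<open>
  Braidings suppressed, \<open>\<epsilon>(a) S(b) = S(a\<^sub>1 b) a\<^sub>2\<close>, since both sides equal
  \<open>S(a\<^sub>1 b\<^sub>1) a\<^sub>2 b\<^sub>2 S(b\<^sub>3)\<close>.
\<close>

lemma counit_antip:
  "deriv hopf_rule [Alg, Alg] [(0, Counit), (0, Antip)]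
     [(0, Comult), (1, Cross), (0, Mult), (0, Antip), (0, Mult)]"
proof -
  let ?d = "deriv hopf_rule [Alg, Alg]"
  have "?d [(0, Counit), (0, Antip)]
     [(1, Comult), (0, Counit), (0, Counit), (0, Antip)]"
    by (rule hopf_rewrite_back[OF counit_left_rule, where n = 0 and k = 1]) code_simp
  also have "?d \<dots> [(1, Comult), (0, Mult), (0, Counit), (0, Antip)]"
    by (rule hopf_rewrite_back[OF counit_mult_rule, where n = 1 and k = 0]) code_simp
  also have "?d \<dots> [(1, Comult), (0, Mult), (0, Counit), (0, Unit), (1, Antip), (0, Mult)]"
    by (rule hopf_rewrite_back[OF unit_left_rule, where n = 4 and k = 0]) code_simp
  also have "?d \<dots> [(1, Comult), (0, Mult), (0, Comult), (0, Antip), (0, Mult), (1, Antip),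
      (0, Mult)]"
    by (rule hopf_rewrite_back[OF antip_left_rule, where n = 2 and k = 0]) code_simp
  also have "?d \<dots> [(1, Comult), (0, Comult), (2, Comult), (1, Cross), (0, Mult), (1, Mult),
      (0, Antip), (2, Antip), (0, Mult), (0, Mult)]"
    by (rule hopf_rewrite[OF comult_mult_rule, where n = 1 and k = 0]) code_simp
  also have "?d \<dots> [(1, Comult), (0, Comult), (2, Comult), (1, Cross), (0, Mult), (3, Antip),
      (0, Antip), (1, Mult), (1, Mult), (0, Mult)]"
    by (rule hopf_rewrite[OF assoc_rule, where n = 8 and k = 0]) code_simp
  also have "?d \<dots> [(0, Comult), (2, Comult), (2, Comult), (1, Cross), (0, Mult), (3, Antip),
      (0, Antip), (2, Mult), (1, Mult), (0, Mult)]"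
    by (rule hopf_rewrite[OF assoc_rule, where n = 7 and k = 1]) code_simp
  also have "?d \<dots> [(0, Comult), (2, Comult), (1, Cross), (0, Mult), (0, Antip), (2, Comult),
      (3, Antip), (2, Mult), (1, Mult), (0, Mult)]"
    by (rule hopf_rewrite[OF coassoc_rule, where n = 1 and k = 2]) code_simp
  also have "?d \<dots> [(0, Comult), (2, Comult), (3, Counit), (1, Cross), (0, Mult), (0, Antip),
      (2, Unit), (1, Mult), (0, Mult)]"
    by (rule hopf_rewrite[OF antip_right_rule, where n = 5 and k = 2]) code_simp
  also have "?d \<dots> [(0, Comult), (1, Cross), (0, Mult), (0, Antip), (2, Unit), (1, Mult),
      (0, Mult)]"
    by (rule hopf_rewrite[OF counit_right_rule, where n = 1 and k = 2]) code_simp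
  also have "?d \<dots> [(0, Comult), (1, Cross), (0, Mult), (0, Antip), (0, Mult)]"
    by (rule hopf_rewrite[OF unit_right_rule, where n = 4 and k = 1]) code_simp
  finally show ?thesis .
qed

text \<open>\<open>S(a b) = S(a\<^sub>1 b) a\<^sub>2 S(a\<^sub>3) = \<epsilon>(a\<^sub>1) S(b) S(a\<^sub>2)\<close>\<close>

lemma antip_mult:
  "deriv hopf_rule [Alg, Alg] [(0, Mult), (0, Antip)]
     [(0, Antip), (1, Antip), (0, Cross), (0, Mult)]"
proof -
  let ?d = "deriv hopf_rule [Alg, Alg]"
  have "?d [(0, Mult), (0, Antip)]
     [(0, Comult), (1, Counit), (0, Mult), (0, Antip)]"
    by (rule hopf_rewrite_back[OF counit_right_rule, where n = 0 and k = 0]) code_simp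
  also have "?d \<dots> [(0, Comult), (1, Cross), (2, Counit), (0, Mult), (0, Antip)]"
    by (rule hopf_rewrite_back[OF cross_counit_left_rule, where n = 1 and k = 1]) code_simp
  also have "?d \<dots> [(0, Comult), (1, Cross), (0, Mult), (0, Antip), (1, Counit), (1, Unit),
      (0, Mult)]"
    by (rule hopf_rewrite_back[OF unit_right_rule, where n = 5 and k = 0]) code_simp
  also have "?d \<dots> [(0, Comult), (1, Cross), (2, Comult), (0, Mult), (0, Antip), (2, Antip),
      (1, Mult), (0, Mult)]"
    by (rule hopf_rewrite_back[OF antip_right_rule, where n = 4 and k = 1]) code_simp
  also have "?d \<dots> [(0, Comult), (1, Comult), (2, Cross), (1, Cross), (0, Mult), (0, Antip),
      (2, Antip), (1, Mult), (0, Mult)]"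
    by (rule hopf_rewrite_back[OF cross_comult_left_rule, where n = 1 and k = 1]) code_simp
  also have "?d \<dots> [(0, Comult), (1, Comult), (2, Cross), (1, Cross), (0, Mult), (0, Antip),
      (2, Antip), (0, Mult), (0, Mult)]"
    by (rule hopf_rewrite_back[OF assoc_rule, where n = 7 and k = 0]) code_simp
  also have "?d \<dots> [(0, Comult), (1, Cross), (0, Comult), (1, Cross), (0, Mult), (0, Antip),
      (0, Mult), (1, Antip), (0, Mult)]"
    by (rule hopf_rewrite_back[OF coassoc_rule, where n = 0 and k = 0]) code_simp
  also have "?d \<dots> [(0, Comult), (0, Counit), (0, Cross), (0, Antip), (1, Antip), (0, Mult)]"
    by (rule deriv_rewrite[OF counit_antip[symmetric], where n = 2 and k = 0]) code_simp
  also have "?d \<dots> [(0, Cross), (0, Antip), (1, Antip), (0, Mult)]"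
    by (rule hopf_rewrite[OF counit_left_rule, where n = 0 and k = 0]) code_simp
  also have "?d \<dots> [(1, Antip), (0, Cross), (1, Antip), (0, Mult)]"
    by (rule hopf_rewrite_back[OF cross_antip_right_rule, where n = 0 and k = 0]) code_simp
  also have "?d \<dots> [(0, Antip), (1, Antip), (0, Cross), (0, Mult)]"
    by (rule hopf_rewrite_back[OF cross_antip_left_rule, where n = 1 and k = 0]) code_simp
  finally show ?thesis .
qed

text \<open>The reflection of \<open>antip_mult\<close>; only the order of the two antipodes has to
  be adjusted.\<close>

lemma antip_comult:
  "deriv hopf_rule [Alg] [(0, Antip), (0, Comult)]
     [(0, Comult), (0, Cross), (0, Antip), (1, Antip)]"
proof -
  have "deriv hopf_rule [Alg] (dual [(0, Mult), (0, Antip)])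
      (dual [(0, Antip), (1, Antip), (0, Cross), (0, Mult)])"
    by (rule deriv_dual[OF antip_mult]) (simp_all add: hopf_diagram_def run.simps)
  also have "deriv hopf_rule [Alg] \<dots> [(0, Comult), (0, Cross), (0, Antip), (1, Antip)]"
    by (rule deriv_interchanges) code_simp+
  finally show ?thesis by (simp add: dual_def)
qed

text \<open>
  The braidings collect to a full twist of the third strand around the first two, whose product
  becomes \<open>S(x\<^sub>1 S(x\<^sub>2)) = \<epsilon>(x)\<close>, so that the twist disappears.
\<close>

lemma antip_antip_split:
  "deriv hopf_rule [Alg] [(0, Comult), (0, Cross), (0, Antip), (0, Antip), (1, Antip),
      (0, Comult), (1, Cross), (0, Mult)]
     [(0, Antip), (0, Antip), (0, Unit)]"
proof -
  let ?d = "deriv hopf_rule [Alg]"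
  have "?d [(0, Comult), (0, Cross), (0, Antip), (0, Antip), (1, Antip), (0, Comult), (1, Cross),
      (0, Mult)]
     [(0, Comult), (0, Cross), (0, Antip), (0, Antip), (0, Comult), (2, Antip), (1, Cross),
      (0, Mult)]"
    by (rule deriv_interchanges) code_simp+
  also have "?d \<dots> [(0, Comult), (0, Cross), (0, Antip), (0, Comult), (0, Cross), (0, Antip),
      (1, Antip), (2, Antip), (1, Cross), (0, Mult)]"
    by (rule deriv_rewrite[OF antip_comult, where n = 3 and k = 0]) code_simp
  also have "?d \<dots> [(0, Comult), (0, Cross), (0, Comult), (0, Cross), (0, Antip), (1, Antip),
      (0, Cross), (0, Antip), (1, Antip), (2, Antip), (1, Cross), (0, Mult)]"
    by (rule deriv_rewrite[OF antip_comult, where n = 2 and k = 0]) code_simp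
  also have "?d \<dots> [(0, Comult), (1, Comult), (0, Cross), (1, Cross), (0, Cross), (0, Antip),
      (1, Antip), (0, Cross), (0, Antip), (2, Antip), (1, Antip), (1, Cross), (0, Mult)]"
    by (rule hopf_rewrite_back[OF cross_comult_right_rule, where n = 1 and k = 0]) code_simp
  also have "?d \<dots> [(0, Comult), (1, Comult), (0, Cross), (1, Cross), (0, Cross), (1, Antip),
      (0, Antip), (0, Cross), (0, Antip), (2, Antip), (1, Cross), (2, Antip), (0, Mult)]"
    by (rule hopf_rewrite[OF cross_antip_left_rule, where n = 10 and k = 1]) code_simp
  also have "?d \<dots> [(0, Comult), (1, Comult), (0, Cross), (1, Cross), (0, Cross), (1, Antip),
      (0, Cross), (2, Antip), (0, Antip), (1, Antip), (1, Cross), (2, Antip), (0, Mult)]"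
    by (rule hopf_rewrite[OF cross_antip_left_rule, where n = 6 and k = 0]) code_simp
  also have "?d \<dots> [(0, Comult), (1, Comult), (0, Cross), (1, Cross), (0, Cross), (1, Antip),
      (0, Cross), (2, Antip), (0, Antip), (1, Cross), (2, Antip), (2, Antip), (0, Mult)]"
    by (rule hopf_rewrite[OF cross_antip_left_rule, where n = 9 and k = 1]) code_simp
  also have "?d \<dots> [(0, Comult), (1, Comult), (0, Cross), (1, Cross), (0, Cross), (0, Cross),
      (0, Antip), (0, Antip), (2, Antip), (1, Cross), (2, Antip), (2, Antip), (0, Mult)]"
    by (rule hopf_rewrite[OF cross_antip_right_rule, where n = 5 and k = 0]) code_simp
  also have "?d \<dots> [(0, Comult), (1, Comult), (0, Cross), (1, Cross), (0, Cross), (0, Cross),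
      (0, Antip), (0, Antip), (1, Cross), (1, Antip), (2, Antip), (2, Antip), (0, Mult)]"
    by (rule hopf_rewrite[OF cross_antip_right_rule, where n = 8 and k = 1]) code_simp
  \<comment> \<open>Two braid relations bring the five crossings into the order 1, 0, 0, 1, 0. The
    first four are the full twist of the third strand around the first two; the last one is absorbed
    by \<open>antip_mult\<close>, read backwards.\<close>
  also have "?d \<dots> [(0, Comult), (1, Comult), (1, Cross), (0, Cross), (1, Cross), (0, Cross),
      (1, Cross), (0, Antip), (0, Antip), (1, Antip), (2, Antip), (2, Antip), (0, Mult)]"
    by (rule hopf_rewrite[OF cross_cross_rule, where n = 2 and k = 0]) code_simp
  also have "?d \<dots> [(0, Comult), (1, Comult), (1, Cross), (0, Cross), (0, Cross), (1, Cross),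
      (0, Cross), (0, Antip), (0, Antip), (1, Antip), (2, Antip), (2, Antip), (0, Mult)]"
    by (rule hopf_rewrite_back[OF cross_cross_rule, where n = 4 and k = 0]) code_simp
  also have "?d \<dots> [(0, Comult), (1, Comult), (1, Cross), (0, Cross), (0, Cross), (1, Cross),
      (1, Antip), (0, Cross), (0, Antip), (1, Antip), (2, Antip), (2, Antip), (0, Mult)]"
    by (rule hopf_rewrite_back[OF cross_antip_right_rule, where n = 6 and k = 0]) code_simp
  also have "?d \<dots> [(0, Comult), (1, Comult), (1, Cross), (0, Cross), (0, Cross), (1, Cross),
      (1, Antip), (1, Antip), (0, Cross), (1, Antip), (2, Antip), (2, Antip), (0, Mult)]"
    by (rule hopf_rewrite_back[OF cross_antip_right_rule, where n = 7 and k = 0]) code_simp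
  also have "?d \<dots> [(0, Comult), (1, Comult), (1, Cross), (0, Cross), (0, Cross), (1, Cross),
      (1, Antip), (0, Antip), (1, Antip), (0, Cross), (0, Mult), (1, Antip), (1, Antip)]"
    by (rule hopf_rewrite_back[OF cross_antip_left_rule, where n = 8 and k = 0]) code_simp
  also have "?d \<dots> [(0, Comult), (1, Comult), (1, Cross), (0, Cross), (0, Cross), (1, Cross),
      (1, Antip), (0, Mult), (0, Antip), (1, Antip), (1, Antip)]"
    by (rule deriv_rewrite[OF antip_mult[symmetric], where n = 7 and k = 0]) code_simp
  also have "?d \<dots> [(0, Comult), (1, Comult), (1, Cross), (2, Antip), (0, Cross), (0, Cross),
      (1, Cross), (0, Mult), (0, Antip), (1, Antip), (1, Antip)]"
    by (rule hopf_rewrite_back[OF cross_antip_right_rule, where n = 5 and k = 1]) code_simp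
  also have "?d \<dots> [(0, Comult), (1, Comult), (1, Antip), (1, Cross), (0, Cross), (0, Cross),
      (1, Cross), (0, Mult), (0, Antip), (1, Antip), (1, Antip)]"
    by (rule hopf_rewrite_back[OF cross_antip_left_rule, where n = 2 and k = 1]) code_simp
  also have "?d \<dots> [(0, Comult), (1, Comult), (1, Antip), (1, Cross), (0, Cross), (1, Mult),
      (0, Cross), (0, Antip), (1, Antip), (1, Antip)]"
    by (rule hopf_rewrite_back[OF cross_mult_right_rule, where n = 5 and k = 0]) code_simp
  also have "?d \<dots> [(0, Comult), (1, Comult), (1, Antip), (0, Mult), (0, Cross), (0, Cross),
      (0, Antip), (1, Antip), (1, Antip)]"
    by (rule hopf_rewrite_back[OF cross_mult_left_rule, where n = 3 and k = 0]) code_simp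
  also have "?d \<dots> [(0, Comult), (0, Comult), (1, Antip), (0, Mult), (0, Cross), (0, Cross),
      (0, Antip), (1, Antip), (1, Antip)]"
    by (rule hopf_rewrite_back[OF coassoc_rule, where n = 0 and k = 0]) code_simp
  also have "?d \<dots> [(0, Comult), (0, Counit), (0, Unit), (0, Cross), (0, Cross), (0, Antip),
      (1, Antip), (1, Antip)]"
    by (rule hopf_rewrite[OF antip_right_rule, where n = 1 and k = 0]) code_simp
  also have "?d \<dots> [(0, Unit), (0, Cross), (0, Cross), (0, Antip), (1, Antip), (1, Antip)]"
    by (rule hopf_rewrite[OF counit_left_rule, where n = 0 and k = 0]) code_simp
  also have "?d \<dots> [(1, Unit), (0, Cross), (0, Antip), (1, Antip), (1, Antip)]"
    by (rule hopf_rewrite[OF cross_unit_left_rule, where n = 0 and k = 0]) code_simp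
  also have "?d \<dots> [(0, Unit), (0, Antip), (1, Antip), (1, Antip)]"
    by (rule hopf_rewrite[OF cross_unit_right_rule, where n = 0 and k = 0]) code_simp
  also have "?d \<dots> [(0, Antip), (0, Antip), (0, Unit)]"
    by (rule deriv_rewrite[OF antip_unit, where n = 0 and k = 0]) code_simp
  finally show ?thesis .
qed

text \<open>Multiplicativity of \<Delta> splits \<open>y = b S\<^sup>2(x\<^sub>2)\<close>. Moving
  the last crossing past the second product and reassociating collects everything that depends on
  \<open>x\<close> into \<open>(S\<^sup>2(x\<^sub>2))\<^sub>1 S(x\<^sub>1) \<otimes>
  (S\<^sup>2(x\<^sub>2))\<^sub>2\<close>, which \<open>antip_antip_split\<close> contracts to
  \<open>1 \<otimes> S\<^sup>2(x)\<close>.\<close>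

lemma comult_antip_antip:
  "deriv hopf_rule [Alg, Alg] [(1, Comult), (1, Cross), (1, Antip), (1, Antip), (2, Antip),
      (0, Mult), (0, Comult), (1, Cross), (0, Mult)]
     [(0, Comult), (2, Antip), (2, Antip), (1, Mult)]"
proof -
  let ?d = "deriv hopf_rule [Alg, Alg]"
  have "?d [(1, Comult), (1, Cross), (1, Antip), (1, Antip), (2, Antip), (0, Mult), (0, Comult),
      (1, Cross), (0, Mult)]
     [(1, Comult), (1, Cross), (1, Antip), (1, Antip), (2, Antip), (0, Comult), (2, Comult),
      (1, Cross), (0, Mult), (1, Mult), (1, Cross), (0, Mult)]"
    by (rule hopf_rewrite[OF comult_mult_rule, where n = 5 and k = 0]) code_simp
  also have "?d \<dots> [(1, Comult), (1, Cross), (1, Antip), (1, Antip), (2, Antip), (0, Comult),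
      (2, Comult), (1, Cross), (3, Cross), (2, Cross), (3, Mult), (0, Mult), (0, Mult)]"
    by (rule hopf_rewrite[OF cross_mult_left_rule, where n = 9 and k = 1]) code_simp
  also have "?d \<dots> [(1, Comult), (1, Cross), (1, Antip), (1, Antip), (2, Antip), (0, Comult),
      (2, Comult), (3, Cross), (1, Cross), (2, Cross), (1, Mult), (2, Mult), (0, Mult)]"
    by (rule hopf_rewrite[OF assoc_rule, where n = 11 and k = 0]) code_simp
  also have "?d \<dots> [(1, Comult), (1, Cross), (1, Antip), (1, Antip), (2, Antip), (1, Comult),
      (2, Cross), (1, Mult), (0, Comult), (1, Cross), (2, Mult), (0, Mult)]"
    by (rule hopf_rewrite_back[OF cross_mult_right_rule, where n = 8 and k = 1]) code_simp
  also have "?d \<dots> [(1, Antip), (1, Antip), (0, Comult), (2, Unit), (1, Cross), (2, Mult),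
      (0, Mult)]"
    by (rule deriv_rewrite[OF antip_antip_split, where n = 0 and k = 1]) code_simp
  also have "?d \<dots> [(1, Antip), (1, Antip), (0, Comult), (1, Mult), (1, Unit), (0, Mult)]"
    by (rule hopf_rewrite[OF cross_unit_right_rule, where n = 3 and k = 1]) code_simp
  also have "?d \<dots> [(0, Comult), (2, Antip), (2, Antip), (1, Mult)]"
    by (rule hopf_rewrite[OF unit_right_rule, where n = 4 and k = 0]) code_simp
  finally show ?thesis .
qed

subsection \<open>The trace\<close>

text \<open>The three crossing rules are naturality of \<Psi> along \<open>\<Delta>\<close>,
  \<open>ev\<close> and \<open>coev\<close>; the last two also use that the braiding with the unit
  object is trivial.\<close>

inductive trace_rule :: "word \<Rightarrow> diagram \<Rightarrow> diagram \<Rightarrow> bool" where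
  hopf: "hopf_rule u l r \<Longrightarrow> trace_rule u l r"
| crossD_comult_rule:
    "trace_rule [Alg, Dual] [(0, Comult), (1, CrossD), (0, CrossD)] [(0, CrossD), (1, Comult)]"
| crossD_ev_rule:
    "trace_rule [Alg, Dual, Alg] [(1, Ev)] [(0, CrossD), (1, Cross), (0, Ev)]"
| crossD_coev_rule: "trace_rule [Alg] [(1, Coev), (0, Cross), (1, CrossD)] [(0, Coev)]"
| snake_rule: "trace_rule [Alg] [(0, Coev), (1, Ev)] []"

lemma trace_rule_run: "trace_rule u l r \<Longrightarrow> \<exists>v. run u l = Some v \<and> run u r = Some v"
  by (induction rule: trace_rule.induct) (simp_all add: run.simps hopf_rule_run)

lemma deriv_trace_rule: "trace_rule u l r \<Longrightarrow> deriv trace_rule u l r"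
  using trace_rule_run by (blast intro: deriv_rule)

lemma hopf_trace: "deriv hopf_rule w D E \<Longrightarrow> deriv trace_rule w D E"
  by (rule deriv_mono[OF hopf])

lemmas trace_rewrite = deriv_rewrite[OF deriv_trace_rule]
lemmas trace_rewrite_back = deriv_rewrite[OF deriv_trace_rule[THEN deriv_sym]]

text \<open>
  The left side is the transpose of \<open>x \<mapsto> S(x\<^sub>1) \<otimes> x\<^sub>2\<close> on the dual, followed by the closing of the
  trace. By naturality the strand being closed passes over the transpose, where the second
  coevaluation straightens.
\<close>

lemma ev_transpose:
  "deriv trace_rule [Alg, Dual] [(2, Coev), (2, Comult), (2, Cross), (1, Ev), (1, Antip),
      (0, Cross), (1, CrossD), (1, Ev)]
     [(0, Comult), (1, CrossD), (1, Ev), (0, Antip)]"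
proof -
  let ?d = "deriv trace_rule [Alg, Dual]"
  have "?d [(2, Coev), (2, Comult), (2, Cross), (1, Ev), (1, Antip), (0, Cross), (1, CrossD),
      (1, Ev)]
     [(2, Coev), (2, Comult), (2, Cross), (0, CrossD), (1, Cross), (0, Ev), (1, Antip),
      (0, Cross), (1, CrossD), (1, Ev)]"
    by (rule trace_rewrite[OF crossD_ev_rule, where n = 3 and k = 0]) code_simp
  also have "?d \<dots> [(2, Coev), (2, Comult), (0, CrossD), (2, Cross), (1, Cross), (2, Cross),
      (0, Ev), (0, Antip), (1, CrossD), (1, Ev)]"
    by (rule trace_rewrite[OF hopf[OF cross_antip_right_rule], where n = 6 and k = 0]) code_simp
  also have "?d \<dots> [(2, Coev), (0, CrossD), (2, Comult), (1, Cross), (2, Cross), (1, Cross),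
      (0, Ev), (0, Antip), (1, CrossD), (1, Ev)]"
    by (rule trace_rewrite_back[OF hopf[OF cross_cross_rule], where n = 3 and k = 1]) code_simp
  also have "?d \<dots> [(0, CrossD), (2, Coev), (1, Cross), (2, CrossD), (1, Comult), (1, Cross),
      (0, Ev), (0, Antip), (1, Ev)]"
    by (rule trace_rewrite[OF hopf[OF cross_comult_right_rule], where n = 2 and k = 1]) code_simp
  also have "?d \<dots> [(0, CrossD), (1, Coev), (2, Ev), (1, Comult), (1, Cross), (0, Ev),
      (0, Antip)]"
    by (rule trace_rewrite[OF crossD_coev_rule, where n = 1 and k = 1]) code_simp
  also have "?d \<dots> [(0, CrossD), (1, Comult), (1, Cross), (0, Ev), (0, Antip)]"
    by (rule trace_rewrite[OF snake_rule, where n = 1 and k = 1]) code_simp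
  also have "?d \<dots> [(0, Comult), (1, CrossD), (0, CrossD), (1, Cross), (0, Ev), (0, Antip)]"
    by (rule trace_rewrite_back[OF crossD_comult_rule, where n = 0 and k = 0]) code_simp
  also have "?d \<dots> [(0, Comult), (1, CrossD), (1, Ev), (0, Antip)]"
    by (rule trace_rewrite_back[OF crossD_ev_rule, where n = 2 and k = 0]) code_simp
  finally show ?thesis .
qed

lemma integral_invariant:
  "deriv trace_rule [Alg] [(0, Comult), (2, Coev), (2, Antip), (2, Antip), (1, Mult), (1, CrossD),
      (1, Ev)]
     [(1, Coev), (1, Antip), (1, Antip), (0, Mult), (0, CrossD), (0, Ev), (0, Unit)]"
proof -
  let ?d = "deriv trace_rule [Alg]"
  have "?d [(0, Comult), (2, Coev), (2, Antip), (2, Antip), (1, Mult), (1, CrossD), (1, Ev)]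
     [(1, Coev), (0, Comult), (2, Antip), (2, Antip), (1, Mult), (1, CrossD), (1, Ev)]"
    by (rule deriv_interchanges) code_simp+
  \<comment> \<open>The identity is read from right to left, for \<open>b\<close> and the strand
    \<open>x\<close> just opened by \<open>Coev\<close>.\<close>
  also have "?d \<dots> [(1, Coev), (1, Comult), (1, Cross), (1, Antip), (1, Antip), (2, Antip),
      (0, Mult), (0, Comult), (1, Cross), (0, Mult), (1, CrossD), (1, Ev)]"
    by (rule deriv_rewrite[OF hopf_trace[OF comult_antip_antip, symmetric], where n = 1 and k = 0])
      code_simp
  \<comment> \<open>The snake is inserted on the strand of \<open>x\<^sub>2\<close>. After
    interchanges its coevaluation opens the trace, while the original one, now at position 3,
    belongs to the transpose treated in \<open>ev_transpose\<close>.\<close>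
  also have "?d \<dots> [(1, Coev), (1, Antip), (1, Antip), (0, Mult), (0, Comult), (3, Coev),
      (3, Comult), (3, Cross), (2, Ev), (2, Antip), (1, Cross), (2, CrossD), (2, Ev), (0, Mult)]"
    by (rule trace_rewrite_back[OF snake_rule, where n = 3 and k = 1]) code_simp
  also have "?d \<dots> [(1, Coev), (1, Antip), (1, Antip), (0, Mult), (0, Comult), (1, Comult),
      (2, CrossD), (2, Ev), (1, Antip), (0, Mult)]"
    by (rule deriv_rewrite[OF ev_transpose, where n = 5 and k = 1]) code_simp
  also have "?d \<dots> [(1, Coev), (1, Antip), (1, Antip), (0, Mult), (0, Comult), (1, CrossD),
      (1, Ev), (0, Comult), (1, Antip), (0, Mult)]"
    by (rule trace_rewrite_back[OF hopf[OF coassoc_rule], where n = 4 and k = 0]) code_simp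
  also have "?d \<dots> [(1, Coev), (1, Antip), (1, Antip), (0, Mult), (0, Comult), (0, Counit),
      (0, CrossD), (0, Ev), (0, Unit)]"
    by (rule trace_rewrite[OF hopf[OF antip_right_rule], where n = 7 and k = 0]) code_simp
  also have "?d \<dots> [(1, Coev), (1, Antip), (1, Antip), (0, Mult), (0, CrossD), (0, Ev),
      (0, Unit)]"
    by (rule trace_rewrite[OF hopf[OF counit_left_rule], where n = 4 and k = 0]) code_simp
  finally show ?thesis .
qed

section \<open>Evaluation of diagrams\<close>

context monoidal_vect_cat
begin

interpretation vector_space "scal C"
  by (rule vector_space_scal)

section \<open>Linear maps, unitors and associators on pure tensors\<close>

abbreviation lin :: "'o \<Rightarrow> 'o \<Rightarrow> ('v \<Rightarrow> 'v) \<Rightarrow> bool" where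
  "lin X Y \<equiv> linear_map C (vspace C X) (vspace C Y)"

lemma lin_in: "\<lbrakk>lin X Y f; x \<in> vspace C X\<rbrakk> \<Longrightarrow> f x \<in> vspace C Y"
  by (simp add: linear_map_def)

lemma lin_id: "lin X X id"
  by (simp add: linear_map_def)

lemma lin_comp: "\<lbrakk>lin X Y f; lin Y Z g\<rbrakk> \<Longrightarrow> lin X Z (g \<circ> f)"
  by (simp add: linear_map_def)

lemma lin_scale: "\<lbrakk>lin X Y f; x \<in> vspace C X\<rbrakk> \<Longrightarrow> f (scal C c x) = scal C c (f x)"
  by (simp add: linear_map_def)

lemma scale_in: "x \<in> vspace C X \<Longrightarrow> scal C c x \<in> vspace C X"
  using subspace_space by (rule subspace_scale)

text \<open>\<open>lift\<close> is chosen only as a map into the whole ambient space; on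
  \<open>X \<otimes> Y\<close>, uniqueness identifies it with the universal map into
  \<open>W\<close>.\<close>

lemma lift_linear_into:
  assumes "module.subspace (scal C) W" "bilinear_map C (vspace C X) (vspace C Y) W b"
  shows "linear_map C (vspace C (X \<otimes> Y)) W (lift C X Y b)"
proof -
  obtain h where h: "linear_map C (vspace C (X \<otimes> Y)) W h"
    "\<forall>x\<in>vspace C X. \<forall>y\<in>vspace C Y. h (pure C X Y x y) = b x y"
    using tensor_universal[OF assms] by blast
  have b: "bilinear_map C (vspace C X) (vspace C Y) UNIV b"
    by (rule bilinear_map_UNIV[OF assms(2)])
  have "lift C X Y b w = h w" if "w \<in> vspace C (X \<otimes> Y)" for w
    by (rule tensor_ext[OF lift_linear[OF b] linear_map_UNIV[OF h(1)] _ that])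
      (simp add: lift_pure[OF b] h(2))
  then show ?thesis using h(1) lift_linear[OF b] by (simp add: linear_map_def)
qed

lemma lin_tmap:
  assumes "lin X X' f" "lin Y Y' g"
  shows "lin (X \<otimes> Y) (X' \<otimes> Y') (tmap C X X' Y Y' f g)"
  unfolding tmap_def by (rule lift_linear_into[OF subspace_space pure_bilinear_comp[OF assms]])

lemma lin_ext:
  assumes "lin (X \<otimes> Y) Z f" "lin (X \<otimes> Y) Z g" "w \<in> vspace C (X \<otimes> Y)"
    and "\<And>x y. \<lbrakk>x \<in> vspace C X; y \<in> vspace C Y\<rbrakk> \<Longrightarrow> f (pure C X Y x y) = g (pure C X Y x y)"
  shows "f w = g w"
  using tensor_ext[OF assms(1,2)[THEN linear_map_UNIV] assms(4,3)] .

lemma tmap_comp: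
  assumes f: "lin X X' f" "lin Y Y' g" "lin X' X'' f'" "lin Y' Y'' g'"
    and w: "w \<in> vspace C (X \<otimes> Y)"
  shows "tmap C X' X'' Y' Y'' f' g' (tmap C X X' Y Y' f g w) =
    tmap C X X'' Y Y'' (f' \<circ> f) (g' \<circ> g) w"
proof -
  have "(tmap C X' X'' Y' Y'' f' g' \<circ> tmap C X X' Y Y' f g) w =
      tmap C X X'' Y Y'' (f' \<circ> f) (g' \<circ> g) w"
    by (rule lin_ext[OF lin_comp[OF lin_tmap[OF f(1,2)] lin_tmap[OF f(3,4)]]
          lin_tmap[OF lin_comp[OF f(1,3)] lin_comp[OF f(2,4)]] w])
      (simp add: tmap_pure f lin_in lin_comp[OF f(1,3)] lin_comp[OF f(2,4)]
        tmap_pure[OF f(1,2)] tmap_pure[OF f(3,4)]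
        tmap_pure[OF lin_comp[OF f(1,3)] lin_comp[OF f(2,4)]] lin_in[OF f(1)] lin_in[OF f(2)])
  then show ?thesis by simp
qed

lemma tmap_cong:
  assumes "lin X X' f" "lin Y Y' g" "lin X X' f'" "lin Y Y' g'"
    and "\<And>x. x \<in> vspace C X \<Longrightarrow> f x = f' x" "\<And>y. y \<in> vspace C Y \<Longrightarrow> g y = g' y"
    and w: "w \<in> vspace C (X \<otimes> Y)"
  shows "tmap C X X' Y Y' f g w = tmap C X X' Y Y' f' g' w"
  by (rule lin_ext[OF lin_tmap[OF assms(1,2)] lin_tmap[OF assms(3,4)] w])
    (simp add: tmap_pure[OF assms(1,2)] tmap_pure[OF assms(3,4)] assms(5,6))

lemma tmap_id:
  assumes "w \<in> vspace C (X \<otimes> Y)"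
  shows "tmap C X X Y Y id id w = w"
  using lin_ext[OF lin_tmap[OF lin_id lin_id] lin_id assms]
  by (simp add: tmap_pure[OF lin_id lin_id])

lemma unit_vec_in: "unit_vec C \<in> vspace C \<one>"
  unfolding space_unit by (rule range_eqI[of _ _ 1]) (simp add: scale_one)

lemma coeff_scale [simp]: "coeff C (scal C c (unit_vec C)) = c"
  unfolding coeff_def by (rule the_equality) (auto simp: unit_vec_nonzero)

lemma scale_coeff: "v \<in> vspace C \<one> \<Longrightarrow> scal C (coeff C v) (unit_vec C) = v"
  by (auto simp: space_unit)

lemma coeff_unit_vec [simp]: "coeff C (unit_vec C) = 1"
  using coeff_scale[of 1] by simp

lemma coeff_linear:
  assumes "v \<in> vspace C \<one>" "w \<in> vspace C \<one>"
  shows "coeff C (v + w) = coeff C v + coeff C w" "coeff C (scal C c v) = c * coeff C v"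
proof -
  obtain a b where "v = scal C a (unit_vec C)" "w = scal C b (unit_vec C)"
    using assms by (auto simp: space_unit)
  then show "coeff C (v + w) = coeff C v + coeff C w" "coeff C (scal C c v) = c * coeff C v"
    by (simp_all flip: scale_left_distrib)
qed

lemma scale_coeff_lin: "x \<in> vspace C X \<Longrightarrow> lin \<one> X (\<lambda>v. scal C (coeff C v) x)"
  by (simp add: linear_map_def coeff_linear scale_left_distrib scale_in)

lemma scale_lin: "lin X X (scal C c)"
  by (simp add: linear_map_def scale_right_distrib scale_in mult.commute)

lemma lunit_pure:
  assumes "v \<in> vspace C \<one>" "x \<in> vspace C X"
  shows "lunit C X (pure C \<one> X v x) = scal C (coeff C v) x"
proof -
  have "bilinear_map C (vspace C \<one>) (vspace C X) (vspace C X) (\<lambda>v x. scal C (coeff C v) x)"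
    using scale_coeff_lin scale_lin by (simp add: bilinear_map_def)
  from lift_pure[OF bilinear_map_UNIV[OF this] assms] show ?thesis by (simp add: lunit_def)
qed

lemma runit_pure:
  assumes "v \<in> vspace C \<one>" "x \<in> vspace C X"
  shows "runit C X (pure C X \<one> x v) = scal C (coeff C v) x"
proof -
  have "bilinear_map C (vspace C X) (vspace C \<one>) (vspace C X) (\<lambda>x v. scal C (coeff C v) x)"
    using scale_coeff_lin scale_lin by (simp add: bilinear_map_def)
  from lift_pure[OF bilinear_map_UNIV[OF this] assms(2,1)] show ?thesis by (simp add: runit_def)
qed

lemmas lunit_lin = hom_linear[OF lunit_hom]
lemmas runit_lin = hom_linear[OF runit_hom]
lemmas lunit_inv_lin = hom_linear[OF lunit_inv_hom]
lemmas runit_inv_lin = hom_linear[OF runit_inv_hom]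
lemmas assoc_lin = hom_linear[OF assoc_hom]
lemmas assoc_inv_lin = hom_linear[OF assoc_inv_hom]

lemma lunit_lunit_inv: "x \<in> vspace C X \<Longrightarrow> lunit C X (lunit_inv C X x) = x"
  by (simp add: lunit_inv_def lunit_pure unit_vec_in)

lemma runit_runit_inv: "x \<in> vspace C X \<Longrightarrow> runit C X (runit_inv C X x) = x"
  by (simp add: runit_inv_def runit_pure unit_vec_in)

lemma pure_scale_left:
  "\<lbrakk>x \<in> vspace C X; y \<in> vspace C Y\<rbrakk> \<Longrightarrow> pure C X Y (scal C c x) y = scal C c (pure C X Y x y)"
  using pure_linear2[of y Y X] by (simp add: linear_map_def)

lemma pure_scale_right:
  "\<lbrakk>x \<in> vspace C X; y \<in> vspace C Y\<rbrakk> \<Longrightarrow> pure C X Y x (scal C c y) = scal C c (pure C X Y x y)"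
  using pure_linear1[of x X Y] by (simp add: linear_map_def)

lemma lunit_inv_lunit:
  assumes "w \<in> vspace C (\<one> \<otimes> X)"
  shows "lunit_inv C X (lunit C X w) = w"
proof -
  have "(lunit_inv C X \<circ> lunit C X) w = id w"
  proof (rule lin_ext[OF lin_comp[OF lunit_lin lunit_inv_lin] lin_id assms])
    fix v x assume "v \<in> vspace C \<one>" "x \<in> vspace C X"
    then show "(lunit_inv C X \<circ> lunit C X) (pure C \<one> X v x) = id (pure C \<one> X v x)"
      by (simp add: lunit_pure lunit_inv_def pure_scale_right unit_vec_in)
        (metis pure_scale_left unit_vec_in scale_coeff)
  qed
  then show ?thesis by simp
qed

lemma runit_inv_runit:
  assumes "w \<in> vspace C (X \<otimes> \<one>)"
  shows "runit_inv C X (runit C X w) = w"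
proof -
  have "(runit_inv C X \<circ> runit C X) w = id w"
  proof (rule lin_ext[OF lin_comp[OF runit_lin runit_inv_lin] lin_id assms])
    fix x v assume "x \<in> vspace C X" "v \<in> vspace C \<one>"
    then show "(runit_inv C X \<circ> runit C X) (pure C X \<one> x v) = id (pure C X \<one> x v)"
      by (simp add: runit_pure runit_inv_def pure_scale_left unit_vec_in)
        (metis pure_scale_right unit_vec_in scale_coeff)
  qed
  then show ?thesis by simp
qed

text \<open>\<open>assoc\<close> is a lift whose values are lifts. The outer one can be evaluated
  only once the inner one is known to be linear in \<open>z\<close>, which is tested on pure tensors
  of \<open>X \<otimes> Y\<close>.\<close>

lemma assoc_pure:
  assumes x: "x \<in> vspace C X" and y: "y \<in> vspace C Y" and z: "z \<in> vspace C Z"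
  shows "assoc C X Y Z (pure C (X \<otimes> Y) Z (pure C X Y x y) z) =
    pure C X (Y \<otimes> Z) x (pure C Y Z y z)"
proof -
  let ?k = "\<lambda>z. lift C X Y (\<lambda>x y. pure C X (Y \<otimes> Z) x (pure C Y Z y z))"
  have b: "bilinear_map C (vspace C X) (vspace C Y) (vspace C (X \<otimes> Y \<otimes> Z))
      (\<lambda>x y. pure C X (Y \<otimes> Z) x (pure C Y Z y z))" if "z \<in> vspace C Z" for z
    using pure_bilinear_comp[OF lin_id pure_linear2[OF that]] by simp
  have l: "lin (X \<otimes> Y) (X \<otimes> Y \<otimes> Z) (?k z)" if "z \<in> vspace C Z" for z
    by (rule lift_linear_into[OF subspace_space b[OF that]])
  have p: "?k z (pure C X Y x y) = pure C X (Y \<otimes> Z) x (pure C Y Z y z)"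
    if "x \<in> vspace C X" "y \<in> vspace C Y" "z \<in> vspace C Z" for x y z
    by (rule lift_pure[OF bilinear_map_UNIV[OF b[OF that(3)]] that(1,2)])
  have tri: "lin Z (X \<otimes> Y \<otimes> Z) (\<lambda>z. pure C X (Y \<otimes> Z) x (pure C Y Z y z))"
    if "x \<in> vspace C X" "y \<in> vspace C Y" for x y
    using lin_comp[OF pure_linear1[OF that(2)] pure_linear1[OF that(1)]] by (simp add: comp_def)
  have add: "lin (X \<otimes> Y) (X \<otimes> Y \<otimes> Z) (\<lambda>w. f w + g w)"
    if "lin (X \<otimes> Y) (X \<otimes> Y \<otimes> Z) f" "lin (X \<otimes> Y) (X \<otimes> Y \<otimes> Z) g" for f g
    using that subspace_add[OF subspace_space]
    by (simp add: linear_map_def scale_right_distrib algebra_simps)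
  have scale: "lin (X \<otimes> Y) (X \<otimes> Y \<otimes> Z) (\<lambda>w. scal C c (f w))"
    if "lin (X \<otimes> Y) (X \<otimes> Y \<otimes> Z) f" for f c
    using lin_comp[OF that scale_lin] by (simp add: comp_def)
  have r: "lin Z (X \<otimes> Y \<otimes> Z) (\<lambda>z. ?k z w)" if w: "w \<in> vspace C (X \<otimes> Y)" for w
    unfolding linear_map_def
  proof (intro conjI ballI allI)
    fix z z' assume z: "z \<in> vspace C Z" and z': "z' \<in> vspace C Z"
    have s: "z + z' \<in> vspace C Z" using subspace_space z z' by (rule subspace_add)
    show "?k (z + z') w = ?k z w + ?k z' w"
      by (rule lin_ext[OF l[OF s] add[OF l[OF z] l[OF z']] w])
        (use tri z z' in \<open>simp only: p s, simp add: linear_map_def\<close>)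
  next
    fix c z assume z: "z \<in> vspace C Z"
    show "?k (scal C c z) w = scal C c (?k z w)"
      by (rule lin_ext[OF l[OF scale_in[OF z]] scale[OF l[OF z]] w])
        (use tri z in \<open>simp only: p scale_in, simp add: linear_map_def\<close>)
  qed (use l w lin_in in blast)
  have "bilinear_map C (vspace C (X \<otimes> Y)) (vspace C Z) (vspace C (X \<otimes> Y \<otimes> Z)) (\<lambda>w z. ?k z w)"
    using l r by (simp add: bilinear_map_def)
  from lift_pure[OF bilinear_map_UNIV[OF this] pure_in[OF x y] z] show ?thesis
    unfolding assoc_def by (simp only: p[OF x y z])
qed

lemma assoc_inv_assoc:
  assumes "w \<in> vspace C ((X \<otimes> Y) \<otimes> Z)"
  shows "assoc_inv C X Y Z (assoc C X Y Z w) = w"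
proof -
  have "(assoc_inv C X Y Z \<circ> assoc C X Y Z) w = id w"
  proof (rule lin_ext[OF lin_comp[OF assoc_lin assoc_inv_lin] lin_id assms])
    fix v z assume v: "v \<in> vspace C (X \<otimes> Y)" and z: "z \<in> vspace C Z"
    have l: "lin (X \<otimes> Y) ((X \<otimes> Y) \<otimes> Z) (\<lambda>v. pure C (X \<otimes> Y) Z v z)" by (rule pure_linear2[OF z])
    have "(assoc_inv C X Y Z \<circ> assoc C X Y Z \<circ> (\<lambda>v. pure C (X \<otimes> Y) Z v z)) v =
        pure C (X \<otimes> Y) Z v z"
      by (rule lin_ext[OF lin_comp[OF l lin_comp[OF assoc_lin assoc_inv_lin]] l v])
        (simp add: z assoc_pure assoc_inv_pure)
    then show "(assoc_inv C X Y Z \<circ> assoc C X Y Z) (pure C (X \<otimes> Y) Z v z) =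
        id (pure C (X \<otimes> Y) Z v z)" by simp
  qed
  then show ?thesis by simp
qed

lemma assoc_assoc_inv:
  assumes "w \<in> vspace C (X \<otimes> Y \<otimes> Z)"
  shows "assoc C X Y Z (assoc_inv C X Y Z w) = w"
proof -
  have "(assoc C X Y Z \<circ> assoc_inv C X Y Z) w = id w"
  proof (rule lin_ext[OF lin_comp[OF assoc_inv_lin assoc_lin] lin_id assms])
    fix x v assume x: "x \<in> vspace C X" and v: "v \<in> vspace C (Y \<otimes> Z)"
    have l: "lin (Y \<otimes> Z) (X \<otimes> Y \<otimes> Z) (pure C X (Y \<otimes> Z) x)" by (rule pure_linear1[OF x])
    have "(assoc C X Y Z \<circ> assoc_inv C X Y Z \<circ> pure C X (Y \<otimes> Z) x) v = pure C X (Y \<otimes> Z) x v"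
      by (rule lin_ext[OF lin_comp[OF l lin_comp[OF assoc_inv_lin assoc_lin]] l v])
        (simp add: x assoc_pure assoc_inv_pure)
    then show "(assoc C X Y Z \<circ> assoc_inv C X Y Z) (pure C X (Y \<otimes> Z) x v) =
        id (pure C X (Y \<otimes> Z) x v)" by simp
  qed
  then show ?thesis by simp
qed

section \<open>Right-nested tensor words and families with an open right end\<close>

fun act :: "'o list \<Rightarrow> 'o \<Rightarrow> 'o" where
  "act [] Z = Z"
| "act (X # u) Z = X \<otimes> act u Z"

text \<open>No trailing unit object is added: \<open>ob [X]\<close> is \<open>X\<close> and
  \<open>ob [X, Y]\<close> is \<open>X \<otimes> Y\<close>, so the structure maps have exactly the
  domains and codomains required by the axioms.\<close>

fun ob :: "'o list \<Rightarrow> 'o" where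
  "ob [] = \<one>"
| "ob [X] = X"
| "ob (X # Y # u) = X \<otimes> ob (Y # u)"

primrec whisk :: "'o list \<Rightarrow> 'o \<Rightarrow> 'o \<Rightarrow> ('v \<Rightarrow> 'v) \<Rightarrow> 'v \<Rightarrow> 'v" where
  "whisk [] Y Z f = f"
| "whisk (X # u) Y Z f = tmap C X X (act u Y) (act u Z) id (whisk u Y Z f)"

text \<open>\<open>ins u Z z\<close> is the map \<open>t \<mapsto> t \<otimes> z\<close> from \<open>ob u\<close> to \<open>act u Z\<close>, up to reassociation.\<close>

fun ins :: "'o list \<Rightarrow> 'o \<Rightarrow> 'v \<Rightarrow> 'v \<Rightarrow> 'v" where
  "ins [] Z z = (\<lambda>t. scal C (coeff C t) z)"
| "ins [X] Z z = (\<lambda>t. pure C X Z t z)"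
| "ins (X # Y # u) Z z = tmap C X X (ob (Y # u)) (act (Y # u) Z) id (ins (Y # u) Z z)"

lemma act_append: "act (u @ v) Z = act u (act v Z)"
  by (induction u) auto

lemma whisk_append: "whisk (u @ v) Y Z f = whisk u (act v Y) (act v Z) (whisk v Y Z f)"
  by (induction u) (auto simp: act_append)

lemma ob_append: "c \<noteq> [] \<Longrightarrow> ob (u @ c) = act u (ob c)"
proof (induction u)
  case (Cons X u)
  then show ?case by (cases "u @ c") auto
qed simp

lemma ins_append: "c \<noteq> [] \<Longrightarrow> ins (u @ c) Z z = whisk u (ob c) (act c Z) (ins c Z z)"
proof (induction u)
  case (Cons X u)
  then obtain Y w where "u @ c = Y # w" by (cases "u @ c") auto
  with Cons show ?case by (simp flip: ob_append act_append)
qed simp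

lemma lin_whisk: "lin Y Z f \<Longrightarrow> lin (act u Y) (act u Z) (whisk u Y Z f)"
  by (induction u) (auto intro: lin_tmap lin_id)

lemma whisk_comp:
  assumes "lin X Y f" "lin Y Z g"
  shows "w \<in> vspace C (act u X) \<Longrightarrow> whisk u Y Z g (whisk u X Y f w) = whisk u X Z (g \<circ> f) w"
proof (induction u arbitrary: w)
  case (Cons A u)
  note l = lin_whisk[OF assms(1), of u] lin_whisk[OF assms(2), of u]
    lin_whisk[OF lin_comp[OF assms], of u]
  have w: "w \<in> vspace C (A \<otimes> act u X)" using Cons.prems by simp
  have "tmap C A A (act u X) (act u Z) id (whisk u Y Z g \<circ> whisk u X Y f) w =
      tmap C A A (act u X) (act u Z) id (whisk u X Z (g \<circ> f)) w"
    by (rule tmap_cong[OF lin_id lin_comp[OF l(1,2)] lin_id l(3) refl _ w])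
      (simp only: comp_apply[of "whisk u Y Z g"] Cons.IH)
  then show ?case using tmap_comp[OF lin_id l(1) lin_id l(2) w] by (simp del: comp_apply)
qed simp

lemma whisk_cong:
  assumes "lin X Y f" "lin X Y g" "\<And>x. x \<in> vspace C X \<Longrightarrow> f x = g x"
  shows "w \<in> vspace C (act u X) \<Longrightarrow> whisk u X Y f w = whisk u X Y g w"
proof (induction u arbitrary: w)
  case (Cons A u)
  show ?case
    using tmap_cong[OF lin_id lin_whisk[OF assms(1), of u] lin_id lin_whisk[OF assms(2), of u]]
      Cons by simp
qed (simp add: assms(3))

lemma whisk_id: "w \<in> vspace C (act u X) \<Longrightarrow> whisk u X X id w = w"
proof (induction u arbitrary: w)
  case (Cons A u)
  have w: "w \<in> vspace C (A \<otimes> act u X)" using Cons.prems by simp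
  have "tmap C A A (act u X) (act u X) id (whisk u X X id) w = tmap C A A (act u X) (act u X) id id w"
    by (rule tmap_cong[OF lin_id lin_whisk[OF lin_id] lin_id lin_id refl _ w])
      (rule trans[OF Cons.IH id_apply[symmetric]])
  then show ?case using tmap_id[OF w] by (simp del: id_apply)
qed simp

lemma lin_ins: "z \<in> vspace C Z \<Longrightarrow> lin (ob u) (act u Z) (ins u Z z)"
proof (induction u rule: ob.induct)
  case (3 X Y u)
  then show ?case by (simp add: lin_tmap lin_id)
qed (simp_all add: scale_coeff_lin pure_linear2)

text \<open>The vectors \<open>ins u Z z t\<close> play the role of the pure tensors
  \<open>t \<otimes> z\<close>, up to reassociation. Peeling off the leftmost factor reduces the
  claim to pure tensors of two factors.\<close>

lemma ins_ext:
  assumes "lin (act u Z) W f" "lin (act u Z) W g"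
    and "\<And>z t. \<lbrakk>z \<in> vspace C Z; t \<in> vspace C (ob u)\<rbrakk> \<Longrightarrow> f (ins u Z z t) = g (ins u Z z t)"
    and "w \<in> vspace C (act u Z)"
  shows "f w = g w"
  using assms
proof (induction u arbitrary: f g w rule: ob.induct)
  case 1
  \<comment> \<open>With \<open>t = unit_vec C\<close>, the vector \<open>ins [] Z z t\<close> is
    \<open>z\<close> itself.\<close>
  then show ?case using unit_vec_in by fastforce
next
  case (2 X)
  then show ?case using lin_ext[of X Z W f g w] by simp
next
  case (3 X Y u)
  have l: "lin (X \<otimes> act (Y # u) Z) W f" "lin (X \<otimes> act (Y # u) Z) W g"
    "w \<in> vspace C (X \<otimes> act (Y # u) Z)" using 3 by simp_all
  show ?case
  proof (rule lin_ext[OF l])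
    fix x y assume x: "x \<in> vspace C X" and y: "y \<in> vspace C (act (Y # u) Z)"
    have "(f \<circ> pure C X (act (Y # u) Z) x) y = (g \<circ> pure C X (act (Y # u) Z) x) y"
    proof (rule 3(1)[OF lin_comp[OF pure_linear1[OF x] l(1)] lin_comp[OF pure_linear1[OF x] l(2)] _ y])
      fix z t assume z: "z \<in> vspace C Z" and t: "t \<in> vspace C (ob (Y # u))"
      have "ins (X # Y # u) Z z (pure C X (ob (Y # u)) x t) =
          pure C X (act (Y # u) Z) x (ins (Y # u) Z z t)"
        using tmap_pure[OF lin_id lin_ins[OF z, of "Y # u"] x t] by simp
      moreover have "pure C X (ob (Y # u)) x t \<in> vspace C (ob (X # Y # u))"
        using pure_in[OF x t] by simp
      ultimately show "(f \<circ> pure C X (act (Y # u) Z) x) (ins (Y # u) Z z t) =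
          (g \<circ> pure C X (act (Y # u) Z) x) (ins (Y # u) Z z t)"
        using 3(4)[OF z] by (metis comp_apply)
    qed
    then show "f (pure C X (act (Y # u) Z) x y) = g (pure C X (act (Y # u) Z) x y)" by simp
  qed
qed

lemma whisk_ins:
  assumes k: "lin Z Z' k" and z: "z \<in> vspace C Z"
  shows "t \<in> vspace C (ob u) \<Longrightarrow> whisk u Z Z' k (ins u Z z t) = ins u Z' (k z) t"
proof (induction u arbitrary: t rule: ob.induct)
  case (2 X)
  then show ?case using tmap_pure[OF lin_id k _ z] by simp
next
  case (3 X Y u)
  have t: "t \<in> vspace C (X \<otimes> ob (Y # u))" using 3(2) by simp
  note l = lin_ins[OF z, of "Y # u"] lin_whisk[OF k, of "Y # u"]
    lin_ins[OF lin_in[OF k z], of "Y # u"]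
  show ?case
    using tmap_comp[OF lin_id l(1) lin_id l(2) t]
      tmap_cong[OF lin_id lin_comp[OF l(1,2)] lin_id l(3) _ _ t] 3(1) by simp
qed (simp add: lin_scale[OF k z])

text \<open>
  \<open>rep u v \<phi> F\<close> means that \<open>\<phi> Z\<close> is \<open>F \<otimes> id : ob u \<otimes> Z \<rightarrow> ob v \<otimes> Z\<close> up to reassociation. Such
  families form a strict monoidal category: the right tensor factors are absorbed in \<open>Z\<close>.
\<close>

definition rep :: "'o list \<Rightarrow> 'o list \<Rightarrow> ('o \<Rightarrow> 'v \<Rightarrow> 'v) \<Rightarrow> ('v \<Rightarrow> 'v) \<Rightarrow> bool" where
  "rep u v \<phi> F \<longleftrightarrow> lin (ob u) (ob v) F \<and> (\<forall>Z. lin (act u Z) (act v Z) (\<phi> Z)) \<and>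
     (\<forall>Z. \<forall>z\<in>vspace C Z. \<forall>t\<in>vspace C (ob u). \<phi> Z (ins u Z z t) = ins v Z z (F t))"

lemma repD:
  assumes "rep u v \<phi> F"
  shows "lin (ob u) (ob v) F" "lin (act u Z) (act v Z) (\<phi> Z)"
    "\<lbrakk>z \<in> vspace C Z; t \<in> vspace C (ob u)\<rbrakk> \<Longrightarrow> \<phi> Z (ins u Z z t) = ins v Z z (F t)"
  using assms by (auto simp: rep_def)

lemma rep_id: "rep u u (\<lambda>Z. id) id"
  by (simp add: rep_def lin_id)

lemma rep_comp: "\<lbrakk>rep u v \<phi> F; rep v w \<psi> G\<rbrakk> \<Longrightarrow> rep u w (\<lambda>Z. \<psi> Z \<circ> \<phi> Z) (G \<circ> F)"
  by (auto simp: rep_def intro: lin_comp dest: lin_in)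

lemma rep_unique:
  assumes "rep u v \<phi> F" "rep u v \<psi> G" "\<And>t. t \<in> vspace C (ob u) \<Longrightarrow> F t = G t"
    and "w \<in> vspace C (act u Z)"
  shows "\<phi> Z w = \<psi> Z w"
  by (rule ins_ext[OF repD(2)[OF assms(1)] repD(2)[OF assms(2)] _ assms(4)])
    (simp add: repD(3)[OF assms(1)] repD(3)[OF assms(2)] assms(3))

text \<open>At \<open>Z = \<one>\<close>, inserting the unit vector after a single object is
  \<open>runit_inv\<close>, which is injective; this recovers \<open>F\<close> from its
  family.\<close>

lemma rep_closed_unique:
  assumes "rep u [X] \<phi> F" "rep u [X] \<psi> G"
    and "\<And>Z w. w \<in> vspace C (act u Z) \<Longrightarrow> \<phi> Z w = \<psi> Z w" and t: "t \<in> vspace C (ob u)"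
  shows "F t = G t"
proof -
  have i: "ins u \<one> (unit_vec C) t \<in> vspace C (act u \<one>)"
    by (rule lin_in[OF lin_ins[OF unit_vec_in] t])
  have "runit_inv C X (F t) = runit_inv C X (G t)"
    using repD(3)[OF assms(1) unit_vec_in t] repD(3)[OF assms(2) unit_vec_in t] assms(3)[OF i]
    by (simp add: runit_inv_def)
  moreover have "F t \<in> vspace C X" "G t \<in> vspace C X"
    using lin_in[OF repD(1)[OF assms(1)] t] lin_in[OF repD(1)[OF assms(2)] t] by simp_all
  ultimately show ?thesis using runit_runit_inv by metis
qed

text \<open>On the vectors \<open>ins u Z z t\<close> the map \<open>k\<close> only replaces
  \<open>z\<close> by \<open>k z\<close>. It may be any linear map, not just a morphism; this
  matters for \<open>k = ins c Z z\<close> in \<open>rep_right\<close>.\<close>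

lemma rep_natural:
  assumes r: "rep u v \<phi> F" and k: "lin Z Z' k" and w: "w \<in> vspace C (act u Z)"
  shows "\<phi> Z' (whisk u Z Z' k w) = whisk v Z Z' k (\<phi> Z w)"
proof -
  have "(\<phi> Z' \<circ> whisk u Z Z' k) w = (whisk v Z Z' k \<circ> \<phi> Z) w"
    by (rule ins_ext[OF lin_comp[OF lin_whisk[OF k] repD(2)[OF r]]
          lin_comp[OF repD(2)[OF r] lin_whisk[OF k]] _ w])
      (simp add: whisk_ins[OF k] repD(3)[OF r] lin_in[OF k] lin_in[OF repD(1)[OF r]])
  then show ?thesis by simp
qed

lemma rep_right:
  assumes r: "rep u v \<phi> F" and c: "c \<noteq> []"
  shows "rep (u @ c) (v @ c) (\<lambda>Z. \<phi> (act c Z)) (\<phi> (ob c))"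
  unfolding rep_def ob_append[OF c] act_append ins_append[OF c]
  using repD(2)[OF r] rep_natural[OF r lin_ins[of _ _ c]] by simp

text \<open>Since \<open>ob [X]\<close> is not \<open>X \<otimes> \<one>\<close>, a strand placed to
  the left of an empty word calls for a right unitor.\<close>

definition left_closed :: "'o \<Rightarrow> 'o list \<Rightarrow> 'o list \<Rightarrow> ('v \<Rightarrow> 'v) \<Rightarrow> 'v \<Rightarrow> 'v" where
  "left_closed X u v F = (if v = [] then runit C X else id) \<circ> tmap C X X (ob u) (ob v) id F \<circ>
     (if u = [] then runit_inv C X else id)"

lemma rep_left:
  assumes r: "rep u v \<phi> F"
  shows "rep (X # u) (X # v) (\<lambda>Z. tmap C X X (act u Z) (act v Z) id (\<phi> Z)) (left_closed X u v F)"
proof -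
  let ?a = "if u = [] then runit_inv C X else id"
  let ?b = "if v = [] then runit C X else id"
  have a: "lin (ob (X # u)) (X \<otimes> ob u) ?a"
    by (cases u) (simp_all add: runit_inv_lin lin_id)
  have b: "lin (X \<otimes> ob v) (ob (X # v)) ?b"
    by (cases v) (simp_all add: runit_lin lin_id)
  have F: "lin (X \<otimes> ob u) (X \<otimes> ob v) (tmap C X X (ob u) (ob v) id F)"
    by (rule lin_tmap[OF lin_id repD(1)[OF r]])
  have ins_a: "ins (X # u) Z z t = tmap C X X (ob u) (act u Z) id (ins u Z z) (?a t)"
    if "z \<in> vspace C Z" "t \<in> vspace C (ob (X # u))" for Z z t
  proof (cases u)
    case Nil
    then show ?thesis
      using that tmap_pure[OF lin_id scale_coeff_lin[OF that(1)], of t X "unit_vec C"] unit_vec_in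
      by (simp add: runit_inv_def)
  qed simp
  have ins_b: "ins (X # v) Z z (?b t) = tmap C X X (ob v) (act v Z) id (ins v Z z) t"
    if z: "z \<in> vspace C Z" and t: "t \<in> vspace C (X \<otimes> ob v)" for Z z t
  proof (cases v)
    case Nil
    have l: "lin (X \<otimes> \<one>) (X \<otimes> Z) (ins [X] Z z \<circ> runit C X)"
      "lin (X \<otimes> \<one>) (X \<otimes> Z) (tmap C X X \<one> Z id (ins [] Z z))"
      using lin_comp[OF runit_lin lin_ins[OF z, of "[X]"]]
        lin_tmap[OF lin_id lin_ins[OF z, of "[]"]] by simp_all
    have "(ins [X] Z z \<circ> runit C X) t = tmap C X X \<one> Z id (ins [] Z z) t"
    proof (rule lin_ext[OF l])
      fix x v assume "x \<in> vspace C X" "v \<in> vspace C \<one>"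
      then show "(ins [X] Z z \<circ> runit C X) (pure C X \<one> x v) =
          tmap C X X \<one> Z id (ins [] Z z) (pure C X \<one> x v)"
        using tmap_pure[OF lin_id scale_coeff_lin[OF z]]
        by (simp add: runit_pure pure_scale_left pure_scale_right z)
    qed (use t Nil in simp)
    then show ?thesis using Nil by simp
  qed simp
  have "tmap C X X (act u Z) (act v Z) id (\<phi> Z) (ins (X # u) Z z t) =
      ins (X # v) Z z (left_closed X u v F t)"
    if z: "z \<in> vspace C Z" and t: "t \<in> vspace C (ob (X # u))" for Z z t
  proof -
    have at: "?a t \<in> vspace C (X \<otimes> ob u)" by (rule lin_in[OF a t])
    have "tmap C X X (act u Z) (act v Z) id (\<phi> Z) (tmap C X X (ob u) (act u Z) id (ins u Z z) (?a t)) =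
        tmap C X X (ob v) (act v Z) id (ins v Z z) (tmap C X X (ob u) (ob v) id F (?a t))"
      unfolding tmap_comp[OF lin_id lin_ins[OF z] lin_id repD(2)[OF r] at]
        tmap_comp[OF lin_id repD(1)[OF r] lin_id lin_ins[OF z] at]
      by (rule tmap_cong[OF lin_comp[OF lin_id lin_id] lin_comp[OF lin_ins[OF z] repD(2)[OF r]]
            lin_comp[OF lin_id lin_id] lin_comp[OF repD(1)[OF r] lin_ins[OF z]] _ _ at])
        (simp_all add: repD(3)[OF r z])
    then show ?thesis
      unfolding ins_a[OF z t] left_closed_def comp_apply using ins_b[OF z lin_in[OF F at]] by simp
  qed
  moreover have "lin (ob (X # u)) (ob (X # v)) (left_closed X u v F)"
    unfolding left_closed_def by (rule lin_comp[OF a lin_comp[OF F b]])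
  moreover have "lin (act (X # u) Z) (act (X # v) Z) (tmap C X X (act u Z) (act v Z) id (\<phi> Z))" for Z
    using lin_tmap[OF lin_id repD(2)[OF r]] by simp
  ultimately show ?thesis by (simp add: rep_def)
qed

text \<open>Only words of length at most 2 matter in \<open>pack\<close> and \<open>unpack\<close>.\<close>

fun pack :: "'o list \<Rightarrow> 'o \<Rightarrow> 'v \<Rightarrow> 'v" where
  "pack [] Z = lunit_inv C Z"
| "pack [X] Z = id"
| "pack (X # Y # u) Z = assoc_inv C X Y Z"

fun unpack :: "'o list \<Rightarrow> 'o \<Rightarrow> 'v \<Rightarrow> 'v" where
  "unpack [] Z = lunit C Z"
| "unpack [X] Z = id"
| "unpack (X # Y # u) Z = assoc C X Y Z"

lemma word_cases_le2:
  assumes "length u \<le> 2"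
  obtains "u = []" | X where "u = [X]" | X Y where "u = [X, Y]"
  using assms by (cases u; cases "tl u"; cases "tl (tl u)") auto

lemma lin_pack: "length u \<le> 2 \<Longrightarrow> lin (act u Z) (ob u \<otimes> Z) (pack u Z)"
  by (erule word_cases_le2) (simp_all add: lunit_inv_lin lin_id assoc_inv_lin)

lemma lin_unpack: "length u \<le> 2 \<Longrightarrow> lin (ob u \<otimes> Z) (act u Z) (unpack u Z)"
  by (erule word_cases_le2) (simp_all add: lunit_lin lin_id assoc_lin)

lemma pack_ins:
  assumes "length u \<le> 2" and z: "z \<in> vspace C Z" and t: "t \<in> vspace C (ob u)"
  shows "pack u Z (ins u Z z t) = pure C (ob u) Z t z"
  using assms(1)
proof (cases rule: word_cases_le2)
  case 1
  then show ?thesis using t z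
    by (simp add: lunit_inv_def pure_scale_right unit_vec_in flip: pure_scale_left)
      (simp add: scale_coeff)
next
  case (3 X Y)
  have l: "lin (X \<otimes> Y) (X \<otimes> Y \<otimes> Z) (tmap C X X Y (Y \<otimes> Z) id (\<lambda>t. pure C Y Z t z))"
    by (rule lin_tmap[OF lin_id pure_linear2[OF z]])
  have t': "t \<in> vspace C (X \<otimes> Y)" using t 3 by simp
  have "(assoc_inv C X Y Z \<circ> tmap C X X Y (Y \<otimes> Z) id (\<lambda>t. pure C Y Z t z)) t =
      pure C (X \<otimes> Y) Z t z"
    by (rule lin_ext[OF lin_comp[OF l assoc_inv_lin] pure_linear2[OF z] t'])
      (simp add: tmap_pure[OF lin_id pure_linear2[OF z]] assoc_inv_pure z)
  then show ?thesis using 3 by simp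
qed simp

lemma unpack_pure:
  assumes "length u \<le> 2" and z: "z \<in> vspace C Z" and t: "t \<in> vspace C (ob u)"
  shows "unpack u Z (pure C (ob u) Z t z) = ins u Z z t"
  using assms(1)
proof (cases rule: word_cases_le2)
  case 1
  then show ?thesis using t z by (simp add: lunit_pure)
next
  case (3 X Y)
  have t': "t \<in> vspace C (X \<otimes> Y)" using t 3 by simp
  have "ins u Z z t \<in> vspace C (X \<otimes> Y \<otimes> Z)"
    using lin_in[OF lin_ins[OF z] t] 3 by simp
  from assoc_assoc_inv[OF this] show ?thesis
    using pack_ins[OF assms] 3 by simp
qed simp

text \<open>\<open>f \<otimes> id\<close> conjugated by the identification of \<open>act u Z\<close>
  with \<open>ob u \<otimes> Z\<close>. Every generator has at most two inputs and two
  outputs.\<close>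

definition family :: "'o list \<Rightarrow> 'o list \<Rightarrow> ('v \<Rightarrow> 'v) \<Rightarrow> 'o \<Rightarrow> 'v \<Rightarrow> 'v" where
  "family u v f Z = unpack v Z \<circ> tmap C (ob u) (ob v) Z Z f id \<circ> pack u Z"

lemma rep_family:
  assumes "length u \<le> 2" "length v \<le> 2" "lin (ob u) (ob v) f"
  shows "rep u v (family u v f) f"
  using assms
  by (auto simp: rep_def family_def pack_ins tmap_pure[OF assms(3) lin_id] unpack_pure lin_in
      intro!: lin_comp lin_pack lin_unpack lin_tmap lin_id)

primrec whisk_closed :: "'o list \<Rightarrow> 'o list \<Rightarrow> 'o list \<Rightarrow> ('v \<Rightarrow> 'v) \<Rightarrow> 'v \<Rightarrow> 'v" where
  "whisk_closed [] u v F = F"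
| "whisk_closed (X # a) u v F = left_closed X (a @ u) (a @ v) (whisk_closed a u v F)"

lemma rep_whisk:
  assumes "rep u v \<phi> F"
  shows "rep (a @ u) (a @ v) (\<lambda>Z. whisk a (act u Z) (act v Z) (\<phi> Z)) (whisk_closed a u v F)"
proof (induction a)
  case (Cons X a)
  from rep_left[OF Cons.IH, of X] show ?case by (simp add: act_append)
qed (simp add: assms)

end

section \<open>Interpretation of diagrams by linear maps\<close>

locale diagram_model = monoidal_vect_cat C
  for C :: "('o, 'v::ab_group_add, 'm) vect_cat_scheme" (structure) +
  fixes obj :: "strand \<Rightarrow> 'o" and val :: "gen \<Rightarrow> 'v \<Rightarrow> 'v"
  assumes val_lin: "lin (ob (map obj (src g))) (ob (map obj (tgt g))) (val g)"
begin

abbreviation obs :: "word \<Rightarrow> 'o list" where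
  "obs \<equiv> map obj"

definition gen_family :: "gen \<Rightarrow> 'o \<Rightarrow> 'v \<Rightarrow> 'v" where
  "gen_family g = family (obs (src g)) (obs (tgt g)) (val g)"

definition layer :: "word \<Rightarrow> gen \<Rightarrow> word \<Rightarrow> 'o \<Rightarrow> 'v \<Rightarrow> 'v" where
  "layer a g c Z = whisk (obs a) (act (obs (src g)) (act (obs c) Z))
     (act (obs (tgt g)) (act (obs c) Z)) (gen_family g (act (obs c) Z))"

definition layer_closed :: "word \<Rightarrow> gen \<Rightarrow> word \<Rightarrow> 'v \<Rightarrow> 'v" where
  "layer_closed a g c = whisk_closed (obs a) (obs (src g @ c)) (obs (tgt g @ c))
     (if c = [] then val g else gen_family g (ob (obs c)))"

fun sem :: "word \<Rightarrow> diagram \<Rightarrow> 'o \<Rightarrow> 'v \<Rightarrow> 'v" where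
  "sem w [] Z = id"
| "sem w ((i, g) # D) Z =
     sem (take i w @ tgt g @ drop (i + length (src g)) w) D Z \<circ>
     layer (take i w) g (drop (i + length (src g)) w) Z"

text \<open>\<open>closed\<close> unfolds to composites with the associators and unitors that occur
  in the axioms, whereas \<open>sem\<close> is the strict interpretation in which rewriting is
  sound; \<open>rep_sem\<close> links the two.\<close>

fun closed :: "word \<Rightarrow> diagram \<Rightarrow> 'v \<Rightarrow> 'v" where
  "closed w [] = id"
| "closed w ((i, g) # D) =
     closed (take i w @ tgt g @ drop (i + length (src g)) w) D \<circ>
     layer_closed (take i w) g (drop (i + length (src g)) w)"

lemma rep_gen: "rep (obs (src g)) (obs (tgt g)) (gen_family g) (val g)"
  unfolding gen_family_def by (rule rep_family[OF _ _ val_lin]) (cases g; simp)+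

lemma rep_layer: "rep (obs (a @ src g @ c)) (obs (a @ tgt g @ c)) (layer a g c) (layer_closed a g c)"
proof -
  have "rep (obs (src g) @ obs c) (obs (tgt g) @ obs c) (\<lambda>Z. gen_family g (act (obs c) Z))
      (if c = [] then val g else gen_family g (ob (obs c)))"
    using rep_gen[of g] rep_right[OF rep_gen[of g], of "obs c"] by auto
  from rep_whisk[OF this, of "obs a"] show ?thesis
    by (simp add: layer_def[abs_def] layer_closed_def act_append)
qed

lemma rep_sem: "run w D = Some v \<Longrightarrow> rep (obs w) (obs v) (sem w D) (closed w D)"
proof (induction D arbitrary: w)
  case Nil
  then show ?case using rep_id by (simp add: rep_def id_def)
next
  case (Cons l D)
  obtain i g where l: "l = (i, g)" by fastforce
  with Cons.prems obtain a c where w: "w = a @ src g @ c" "length a = i"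
    and r: "run (a @ tgt g @ c) D = Some v" by (auto simp: run_layer_iff)
  have "sem w (l # D) = (\<lambda>Z. sem (a @ tgt g @ c) D Z \<circ> layer a g c Z)"
    "closed w (l # D) = closed (a @ tgt g @ c) D \<circ> layer_closed a g c"
    using l w by auto
  then show ?case
    using rep_comp[OF rep_layer Cons.IH[OF r]] w by (simp add: comp_def)
qed

lemma sem_append: "run w D = Some v \<Longrightarrow> sem w (D @ E) Z x = sem v E Z (sem w D Z x)"
  by (induction w D Z arbitrary: x rule: sem.induct) (auto simp: run.simps(2) split: if_splits)

lemma layer_append:
  "layer (a @ p) g (q @ b) Z = whisk (obs a) (act (obs (p @ src g @ q)) (act (obs b) Z))
     (act (obs (p @ tgt g @ q)) (act (obs b) Z)) (layer p g q (act (obs b) Z))"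
  by (simp add: layer_def whisk_append act_append)

lemma lin_layer: "lin (act (obs (a @ src g @ c)) Z) (act (obs (a @ tgt g @ c)) Z) (layer a g c Z)"
  by (rule repD(2)[OF rep_layer])

lemma lin_sem: "run w D = Some v \<Longrightarrow> lin (act (obs w) Z) (act (obs v) Z) (sem w D Z)"
  by (rule repD(2)[OF rep_sem])

lemma sem_shift:
  assumes "run u D = Some v" "x \<in> vspace C (act (obs (a @ u @ b)) Z)"
  shows "sem (a @ u @ b) (shift (length a) D) Z x =
    whisk (obs a) (act (obs u) (act (obs b) Z)) (act (obs v) (act (obs b) Z))
      (sem u D (act (obs b) Z)) x"
  using assms
proof (induction D arbitrary: u x)
  case Nil
  then have "x \<in> vspace C (act (obs a) (act (obs v) (act (obs b) Z)))" "u = v"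
    by (simp_all add: act_append)
  then show ?case using whisk_id by (simp add: shift_def id_def)
next
  case (Cons l D)
  obtain i g where l: "l = (i, g)" by fastforce
  with Cons.prems obtain p q where u: "u = p @ src g @ q" "length p = i"
    and r: "run (p @ tgt g @ q) D = Some v" by (auto simp: run_layer_iff)
  have x: "x \<in> vspace C (act (obs a) (act (obs (p @ src g @ q)) (act (obs b) Z)))"
    using Cons.prems(2) u by (simp add: act_append)
  let ?y = "layer (a @ p) g (q @ b) Z x"
  have "x \<in> vspace C (act (obs ((a @ p) @ src g @ q @ b)) Z)"
    using Cons.prems(2) u by simp
  then have y: "?y \<in> vspace C (act (obs (a @ (p @ tgt g @ q) @ b)) Z)"
    using lin_in[OF lin_layer[of "a @ p" g "q @ b" Z]] by simp
  have "sem (a @ u @ b) (shift (length a) (l # D)) Z x =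
      sem (a @ (p @ tgt g @ q) @ b) (shift (length a) D) Z ?y"
    using l u by (simp add: shift_def)
  also have "\<dots> = whisk (obs a) (act (obs (p @ tgt g @ q)) (act (obs b) Z)) (act (obs v) (act (obs b) Z))
      (sem (p @ tgt g @ q) D (act (obs b) Z)) ?y"
    by (rule Cons.IH[OF r y])
  also have "\<dots> = whisk (obs a) (act (obs (p @ src g @ q)) (act (obs b) Z)) (act (obs v) (act (obs b) Z))
      (sem (p @ tgt g @ q) D (act (obs b) Z) \<circ> layer p g q (act (obs b) Z)) x"
    unfolding layer_append by (rule whisk_comp[OF lin_layer lin_sem[OF r] x])
  finally show ?case using l u by (simp add: comp_def)
qed

text \<open>The layer of \<open>h\<close> acts inside the open right end of the family of
  \<open>g\<close>, so the two commute by naturality of that family in its right end.\<close>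

lemma sem_interchange:
  assumes x: "x \<in> vspace C (act (obs (a @ src g @ b @ src h @ c)) Z)"
  shows "layer (a @ tgt g @ b) h c Z (layer a g (b @ src h @ c) Z x) =
    layer a g (b @ tgt h @ c) Z (layer (a @ src g @ b) h c Z x)"
proof -
  let ?A = "act (obs (b @ src h @ c)) Z" and ?B = "act (obs (b @ tgt h @ c)) Z"
  let ?k = "layer b h c Z"
  have l: "layer (a @ w @ b) h c Z = whisk (obs a) (act (obs w) ?A) (act (obs w) ?B)
      (whisk (obs w) ?A ?B ?k)" for w
    by (simp add: layer_def whisk_append act_append)
  have g: "layer a g (b @ w @ c) Z = whisk (obs a) (act (obs (src g)) (act (obs (b @ w @ c)) Z))
      (act (obs (tgt g)) (act (obs (b @ w @ c)) Z)) (gen_family g (act (obs (b @ w @ c)) Z))" for w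
    by (simp add: layer_def)
  note lk = lin_whisk[OF lin_layer[of b h c Z]]
  have x': "x \<in> vspace C (act (obs a) (act (obs (src g)) ?A))"
    using x by (simp add: act_append)
  have "whisk (obs a) (act (obs (tgt g)) ?A) (act (obs (tgt g)) ?B) (whisk (obs (tgt g)) ?A ?B ?k)
      (whisk (obs a) (act (obs (src g)) ?A) (act (obs (tgt g)) ?A) (gen_family g ?A) x) =
    whisk (obs a) (act (obs (src g)) ?B) (act (obs (tgt g)) ?B) (gen_family g ?B)
      (whisk (obs a) (act (obs (src g)) ?A) (act (obs (src g)) ?B) (whisk (obs (src g)) ?A ?B ?k) x)"
    unfolding whisk_comp[OF repD(2)[OF rep_gen] lk x'] whisk_comp[OF lk repD(2)[OF rep_gen] x']
    by (rule whisk_cong[OF lin_comp[OF repD(2)[OF rep_gen] lk] lin_comp[OF lk repD(2)[OF rep_gen]] _ x'])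
      (simp only: comp_apply rep_natural[OF rep_gen lin_layer])
  then show ?thesis unfolding l g .
qed

lemma deriv_sound:
  assumes "\<And>u l r Z x. \<lbrakk>R u l r; x \<in> vspace C (act (obs u) Z)\<rbrakk> \<Longrightarrow> sem u l Z x = sem u r Z x"
    and "deriv R w D E" "x \<in> vspace C (act (obs w) Z)"
  shows "sem w D Z x = sem w E Z x"
  using assms(2,3)
\<comment> \<open>\<open>Z\<close> is generalised because whiskering by \<open>b\<close> on the
  right evaluates the smaller diagrams at \<open>act (obs b) Z\<close>.\<close>
proof (induction arbitrary: x Z)
  case (deriv_rule u l r v)
  then show ?case using assms(1) by blast
next
  case (deriv_interchange a g b h c)
  from sem_interchange[OF this] show ?case by (simp add: add.assoc)
next
  case (deriv_whisker u D E a b)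
  from deriv_run[OF deriv_whisker.hyps] obtain v where v: "run u D = Some v" "run u E = Some v"
    by blast
  have x: "x \<in> vspace C (act (obs a) (act (obs u) (act (obs b) Z)))"
    using deriv_whisker.prems by (simp add: act_append)
  show ?case
    unfolding sem_shift[OF v(1) deriv_whisker.prems] sem_shift[OF v(2) deriv_whisker.prems]
    by (rule whisk_cong[OF lin_sem[OF v(1)] lin_sem[OF v(2)] deriv_whisker.IH x])
next
  case (deriv_append u D D' v E E')
  have "run u D' = Some v" using deriv_run[OF deriv_append.hyps(1)] deriv_append.hyps(2) by auto
  then show ?case
    using deriv_append lin_in[OF lin_sem[OF deriv_append.hyps(2)] deriv_append.prems]
    by (simp add: sem_append)
qed auto

text \<open>The gate through which axioms enter: a rule needs to be verified only for the closed
  composites.\<close>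

lemma sem_eqI:
  assumes "run u l = Some v" "run u r = Some v"
    and "\<And>t. t \<in> vspace C (ob (obs u)) \<Longrightarrow> closed u l t = closed u r t"
    and "x \<in> vspace C (act (obs u) Z)"
  shows "sem u l Z x = sem u r Z x"
  by (rule rep_unique[OF rep_sem[OF assms(1)] rep_sem[OF assms(2)] assms(3,4)])

end

section \<open>Naturality of associators and unitors, and the braiding with the unit object\<close>

context monoidal_vect_cat
begin

lemma assoc_natural:
  assumes f: "lin X X' f" "lin Y Y' g" "lin Z Z' h" and w: "w \<in> vspace C ((X \<otimes> Y) \<otimes> Z)"
  shows "assoc C X' Y' Z' (tmap C (X \<otimes> Y) (X' \<otimes> Y') Z Z' (tmap C X X' Y Y' f g) h w) =
    tmap C X X' (Y \<otimes> Z) (Y' \<otimes> Z') f (tmap C Y Y' Z Z' g h) (assoc C X Y Z w)"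
proof -
  let ?l = "assoc C X' Y' Z' \<circ> tmap C (X \<otimes> Y) (X' \<otimes> Y') Z Z' (tmap C X X' Y Y' f g) h"
  let ?r = "tmap C X X' (Y \<otimes> Z) (Y' \<otimes> Z') f (tmap C Y Y' Z Z' g h) \<circ> assoc C X Y Z"
  note t = lin_tmap[OF f(1,2)] lin_tmap[OF f(2,3)]
  note l = lin_comp[OF lin_tmap[OF t(1) f(3)] assoc_lin] lin_comp[OF assoc_lin lin_tmap[OF f(1) t(2)]]
  have "?l w = ?r w"
  proof (rule lin_ext[OF l w])
    fix v z assume v: "v \<in> vspace C (X \<otimes> Y)" and z: "z \<in> vspace C Z"
    have p: "lin (X \<otimes> Y) ((X \<otimes> Y) \<otimes> Z) (\<lambda>v. pure C (X \<otimes> Y) Z v z)" by (rule pure_linear2[OF z])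
    have "(?l \<circ> (\<lambda>v. pure C (X \<otimes> Y) Z v z)) v = (?r \<circ> (\<lambda>v. pure C (X \<otimes> Y) Z v z)) v"
      by (rule lin_ext[OF lin_comp[OF p l(1)] lin_comp[OF p l(2)] v])
        (simp add: z tmap_pure[OF t(1) f(3)] tmap_pure[OF f(1,2)] tmap_pure[OF f(2,3)]
          tmap_pure[OF f(1) t(2)] assoc_pure pure_in lin_in[OF f(1)] lin_in[OF f(2)] lin_in[OF f(3)])
    then show "?l (pure C (X \<otimes> Y) Z v z) = ?r (pure C (X \<otimes> Y) Z v z)" by simp
  qed
  then show ?thesis by simp
qed

lemma lunit_natural:
  assumes f: "lin X Y f" and w: "w \<in> vspace C (\<one> \<otimes> X)"
  shows "f (lunit C X w) = lunit C Y (tmap C \<one> \<one> X Y id f w)"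
proof -
  have "(f \<circ> lunit C X) w = (lunit C Y \<circ> tmap C \<one> \<one> X Y id f) w"
    by (rule lin_ext[OF lin_comp[OF lunit_lin f] lin_comp[OF lin_tmap[OF lin_id f] lunit_lin] w])
      (simp add: tmap_pure[OF lin_id f] lunit_pure lin_in[OF f] lin_scale[OF f])
  then show ?thesis by simp
qed

lemma lin_cong:
  assumes "lin X Y f" "\<And>x. x \<in> vspace C X \<Longrightarrow> g x = f x"
  shows "lin X Y g"
proof -
  have "x + y \<in> vspace C X" if "x \<in> vspace C X" "y \<in> vspace C X" for x y
    using module.subspace_add[OF _ subspace_space that] vector_space_scal
    by (simp add: module_iff_vector_space)
  then show ?thesis
    using assms(1) scale_in unfolding linear_map_def by (simp add: assms(2))
qed

end

context braided_vect_cat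
begin

lemma braid_hom: "braid C X Y \<in> hom C (X \<otimes> Y) (Y \<otimes> X)"
  using braid_invertible by (simp add: invertible_hom_def)

lemmas braid_lin = hom_linear[OF braid_hom]

lemma braid_inj:
  assumes "braid C X Y v = braid C X Y w" "v \<in> vspace C (X \<otimes> Y)" "w \<in> vspace C (X \<otimes> Y)"
  shows "v = w"
proof -
  obtain g where "map_eq C (X \<otimes> Y) (g \<circ> braid C X Y) id"
    using braid_invertible[of X Y] by (auto simp: invertible_hom_def)
  then have "g (braid C X Y v) = v" "g (braid C X Y w) = w"
    using assms(2,3) by (simp_all add: map_eq_def)
  with assms(1) show ?thesis by metis
qed

lemma braid_tmap:
  "\<lbrakk>f \<in> hom C X X'; g \<in> hom C Y Y'; w \<in> vspace C (X \<otimes> Y)\<rbrakk> \<Longrightarrow>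
    braid C X' Y' (tmap C X X' Y Y' f g w) = tmap C Y Y' X X' g f (braid C X Y w)"
  using braid_natural[of f X X' g Y Y'] by (simp add: map_eq_def)

lemma hexagon_right:
  assumes w: "w \<in> vspace C (X \<otimes> Y \<otimes> Z)"
  shows "tmap C Y Y (X \<otimes> Z) (Z \<otimes> X) id (braid C X Z) (assoc C Y X Z
      (tmap C (X \<otimes> Y) (Y \<otimes> X) Z Z (braid C X Y) id (assoc_inv C X Y Z w))) =
    assoc C Y Z X (braid C X (Y \<otimes> Z) w)"
  using hexagon1[of X Y Z] lin_in[OF assoc_inv_lin w] assoc_assoc_inv[OF w]
  by (simp add: map_eq_def) metis

lemma hexagon_left:
  assumes w: "w \<in> vspace C (X \<otimes> Y \<otimes> Z)"
  shows "assoc C Z X Y (tmap C (X \<otimes> Z) (Z \<otimes> X) Y Y (braid C X Z) id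
      (assoc_inv C X Z Y (tmap C X X (Y \<otimes> Z) (Z \<otimes> Y) id (braid C Y Z) w))) =
    braid C (X \<otimes> Y) Z (assoc_inv C X Y Z w)"
  using hexagon2[of X Y Z] w
    assoc_assoc_inv[OF lin_in[OF braid_lin lin_in[OF assoc_inv_lin w]]]
  by (simp add: map_eq_def)

text \<open>
  By the hexagon for \<open>X \<otimes> (\<one> \<otimes> \<one>)\<close>, the automorphism of \<open>X\<close> given by the braiding with the unit
  object is idempotent.
\<close>

lemma braid_unit_right:
  assumes x: "x \<in> vspace C X"
  shows "braid C X \<one> (runit_inv C X x) = lunit_inv C X x"
proof -
  let ?u = "unit_vec C" and ?r = "runit_inv C \<one>"
  define p where "p y = lunit C X (braid C X \<one> (runit_inv C X y))" for y
  have p: "p y \<in> vspace C X" "braid C X \<one> (pure C X \<one> y ?u) = pure C \<one> X ?u (p y)"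
    if "y \<in> vspace C X" for y
  proof -
    have "braid C X \<one> (runit_inv C X y) \<in> vspace C (\<one> \<otimes> X)"
      by (rule lin_in[OF braid_lin lin_in[OF runit_inv_lin that]])
    from lunit_inv_lunit[OF this] lin_in[OF lunit_lin this]
    show "p y \<in> vspace C X" "braid C X \<one> (pure C X \<one> y ?u) = pure C \<one> X ?u (p y)"
      by (simp_all add: p_def lunit_inv_def runit_inv_def)
  qed
  note u = unit_vec_in and px = p(1)[OF x]
  let ?w = "pure C X (\<one> \<otimes> \<one>) x (pure C \<one> \<one> ?u ?u)"
  \<comment> \<open>Naturality along \<open>runit_inv C \<one>\<close>, a morphism from
    \<open>\<one>\<close> to \<open>\<one> \<otimes> \<one>\<close>, evaluates this braiding with
    one \<open>p\<close>; the hexagon evaluates it with two.\<close>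
  have "assoc C \<one> \<one> X (braid C X (\<one> \<otimes> \<one>) ?w) =
      assoc C \<one> \<one> X (tmap C \<one> (\<one> \<otimes> \<one>) X X ?r id (pure C \<one> X ?u (p x)))"
    using braid_tmap[OF id_hom runit_inv_hom pure_in[OF x u]] tmap_pure[OF lin_id runit_inv_lin x u]
      p(2)[OF x] by (simp add: runit_inv_def)
  also have "\<dots> = pure C \<one> (\<one> \<otimes> X) ?u (pure C \<one> X ?u (p x))"
    using tmap_pure[OF runit_inv_lin lin_id u px] assoc_pure[OF u u px] by (simp add: runit_inv_def)
  finally have "assoc C \<one> \<one> X (braid C X (\<one> \<otimes> \<one>) ?w) =
      pure C \<one> (\<one> \<otimes> X) ?u (pure C \<one> X ?u (p x))" .
  moreover have "tmap C \<one> \<one> (X \<otimes> \<one>) (\<one> \<otimes> X) id (braid C X \<one>) (assoc C \<one> X \<one>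
      (tmap C (X \<otimes> \<one>) (\<one> \<otimes> X) \<one> \<one> (braid C X \<one>) id (assoc_inv C X \<one> \<one> ?w))) =
      pure C \<one> (\<one> \<otimes> X) ?u (pure C \<one> X ?u (p (p x)))"
    using assoc_inv_pure[OF x u u] tmap_pure[OF braid_lin lin_id pure_in[OF x u] u] p(2)[OF x]
      assoc_pure[OF u px u] tmap_pure[OF lin_id braid_lin u pure_in[OF px u]] p(2)[OF px] by simp
  ultimately have "lunit_inv C (\<one> \<otimes> X) (lunit_inv C X (p (p x))) =
      lunit_inv C (\<one> \<otimes> X) (lunit_inv C X (p x))"
    using hexagon_right[OF pure_in[OF x pure_in[OF u u]]] by (simp add: lunit_inv_def)
  then have "p (p x) = p x"
    using lunit_lunit_inv p(1)[OF px] px lin_in[OF lunit_inv_lin] by metis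
  then have "braid C X \<one> (runit_inv C X (p x)) = braid C X \<one> (runit_inv C X x)"
    using p(2)[OF px] p(2)[OF x] by (simp add: runit_inv_def)
  then have "runit_inv C X (p x) = runit_inv C X x"
    by (rule braid_inj) (rule lin_in[OF runit_inv_lin], fact)+
  then have "p x = x" using runit_runit_inv px x by metis
  then show ?thesis using p(2)[OF x] by (simp add: runit_inv_def lunit_inv_def)
qed

text \<open>The mirror image of \<open>braid_unit_right\<close>: the second hexagon, for
  \<open>\<one> \<otimes> \<one> \<otimes> X\<close>, gives \<open>p (p x) = p x\<close>, and
  injectivity of the braiding turns this into \<open>p x = x\<close>.\<close>

lemma braid_unit_left:
  assumes x: "x \<in> vspace C X"
  shows "braid C \<one> X (lunit_inv C X x) = runit_inv C X x"
proof -
  let ?u = "unit_vec C" and ?r = "runit_inv C \<one>"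
  define p where "p y = runit C X (braid C \<one> X (lunit_inv C X y))" for y
  have p: "p y \<in> vspace C X" "braid C \<one> X (pure C \<one> X ?u y) = pure C X \<one> (p y) ?u"
    if "y \<in> vspace C X" for y
  proof -
    have "braid C \<one> X (lunit_inv C X y) \<in> vspace C (X \<otimes> \<one>)"
      by (rule lin_in[OF braid_lin lin_in[OF lunit_inv_lin that]])
    from runit_inv_runit[OF this] lin_in[OF runit_lin this]
    show "p y \<in> vspace C X" "braid C \<one> X (pure C \<one> X ?u y) = pure C X \<one> (p y) ?u"
      by (simp_all add: p_def lunit_inv_def runit_inv_def)
  qed
  note u = unit_vec_in and px = p(1)[OF x]
  let ?w = "pure C \<one> (\<one> \<otimes> X) ?u (pure C \<one> X ?u x)"
  have "braid C (\<one> \<otimes> \<one>) X (assoc_inv C \<one> \<one> X ?w) = pure C X (\<one> \<otimes> \<one>) (p x) (pure C \<one> \<one> ?u ?u)"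
    using braid_tmap[OF runit_inv_hom id_hom pure_in[OF u x]] tmap_pure[OF runit_inv_lin lin_id u x]
      p(2)[OF x] assoc_inv_pure[OF u u x] tmap_pure[OF lin_id runit_inv_lin px u]
    by (simp add: runit_inv_def)
  moreover have "assoc C X \<one> \<one> (tmap C (\<one> \<otimes> X) (X \<otimes> \<one>) \<one> \<one> (braid C \<one> X) id
      (assoc_inv C \<one> X \<one> (tmap C \<one> \<one> (\<one> \<otimes> X) (X \<otimes> \<one>) id (braid C \<one> X) ?w))) =
      pure C X (\<one> \<otimes> \<one>) (p (p x)) (pure C \<one> \<one> ?u ?u)"
    using assoc_inv_pure[OF u px u] tmap_pure[OF braid_lin lin_id pure_in[OF u px] u] p(2)[OF x]
      assoc_pure[OF p(1)[OF px] u u] tmap_pure[OF lin_id braid_lin u pure_in[OF u x]] p(2)[OF px]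
    by simp
  ultimately have "assoc_inv C X \<one> \<one> (pure C X (\<one> \<otimes> \<one>) (p (p x)) (pure C \<one> \<one> ?u ?u)) =
      assoc_inv C X \<one> \<one> (pure C X (\<one> \<otimes> \<one>) (p x) (pure C \<one> \<one> ?u ?u))"
    using hexagon_left[OF pure_in[OF u pure_in[OF u x]]] by simp
  then have "runit_inv C (X \<otimes> \<one>) (runit_inv C X (p (p x))) =
      runit_inv C (X \<otimes> \<one>) (runit_inv C X (p x))"
    using assoc_inv_pure[OF p(1)[OF px] u u] assoc_inv_pure[OF px u u] by (simp add: runit_inv_def)
  then have "p (p x) = p x"
    using runit_runit_inv p(1)[OF px] px lin_in[OF runit_inv_lin] by metis
  then have "braid C \<one> X (lunit_inv C X (p x)) = braid C \<one> X (lunit_inv C X x)"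
    using p(2)[OF px] p(2)[OF x] by (simp add: lunit_inv_def)
  then have "lunit_inv C X (p x) = lunit_inv C X x"
    by (rule braid_inj) (rule lin_in[OF lunit_inv_lin], fact)+
  then have "p x = x" using lunit_lunit_inv px x by metis
  then show ?thesis using p(2)[OF x] by (simp add: runit_inv_def lunit_inv_def)
qed

lemma lunit_braid: "w \<in> vspace C (X \<otimes> \<one>) \<Longrightarrow> lunit C X (braid C X \<one> w) = runit C X w"
  using braid_unit_right[of "runit C X w" X] lin_in[OF runit_lin, of w X]
  by (simp add: runit_inv_runit lunit_lunit_inv)

lemma runit_braid: "w \<in> vspace C (\<one> \<otimes> X) \<Longrightarrow> runit C X (braid C \<one> X w) = lunit C X w"
  using braid_unit_left[of "lunit C X w" X] lin_in[OF lunit_lin, of w X]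
  by (simp add: lunit_inv_lunit runit_runit_inv)

end

section \<open>Soundness of the rules in a braided group with a dual\<close>

locale dual_braided_group = braided_group C B m \<eta> \<Delta> \<epsilon> S
  for C :: "('o, 'v::ab_group_add, 'm) vect_cat_scheme" (structure)
    and B m \<eta> \<Delta> \<epsilon> S +
  fixes Bd :: 'o and ev coev :: "'v \<Rightarrow> 'v"
  assumes dual: "is_dual C B Bd ev coev"
begin

definition obj :: "strand \<Rightarrow> 'o" where
  "obj s = (case s of Alg \<Rightarrow> B | Dual \<Rightarrow> Bd)"

definition val :: "gen \<Rightarrow> 'v \<Rightarrow> 'v" where
  "val g = (case g of Mult \<Rightarrow> m | Unit \<Rightarrow> \<eta> | Comult \<Rightarrow> \<Delta> | Counit \<Rightarrow> \<epsilon> | Antip \<Rightarrow> S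
     | Cross \<Rightarrow> braid C B B | CrossD \<Rightarrow> braid C B Bd | Ev \<Rightarrow> ev | Coev \<Rightarrow> coev)"

lemma obj [simp]: "obj Alg = B" "obj Dual = Bd"
  by (simp_all add: obj_def)

lemma val [simp]:
  "val Mult = m" "val Unit = \<eta>" "val Comult = \<Delta>" "val Counit = \<epsilon>" "val Antip = S"
  "val Cross = braid C B B" "val CrossD = braid C B Bd" "val Ev = ev" "val Coev = coev"
  by (simp_all add: val_def)

lemma ev_hom: "ev \<in> hom C (Bd \<otimes> B) \<one>" and coev_hom: "coev \<in> hom C \<one> (B \<otimes> Bd)"
  using dual by (simp_all add: is_dual_def)

lemmas val_homs = mult_hom unit_hom comult_hom counit_hom antipode_hom braid_hom ev_hom coev_hom
lemmas val_lins = val_homs[THEN hom_linear]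

sublocale diagram_model C obj val
proof
  show "lin (ob (map obj (src g))) (ob (map obj (tgt g))) (val g)" for g
    by (cases g) (simp_all add: val_lins)
qed

lemmas closed_simps = closed.simps layer_closed_def gen_family_def family_def left_closed_def

text \<open>Unfolding \<open>closed\<close> leaves the axiom itself once inverse associators and
  unitors cancel. The crossing rules follow from naturality together with a hexagon, or with the
  trivial braiding with \<open>\<one>\<close>.\<close>

lemma hopf_rule_closed:
  assumes "hopf_rule u l r" "t \<in> vspace C (ob (obs u))"
  shows "closed u l t = closed u r t"
  using assms
proof (induction rule: hopf_rule.induct)
  case assoc_rule
  then have "t \<in> vspace C (B \<otimes> B \<otimes> B)" by simp
  then show ?case
    using mult_assoc lin_in[OF assoc_inv_lin] by (simp add: closed_simps map_eq_def assoc_assoc_inv)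
next
  case unit_left_rule
  then show ?case
    using mult_unit_left lin_in[OF lunit_inv_lin]
    by (simp add: closed_simps map_eq_def lunit_lunit_inv)
next
  case unit_right_rule
  then show ?case
    using mult_unit_right lin_in[OF runit_inv_lin]
    by (simp add: closed_simps map_eq_def runit_runit_inv)
next
  case coassoc_rule
  then show ?case using comult_coassoc by (simp add: closed_simps map_eq_def)
next
  case counit_left_rule
  then show ?case using counit_left by (simp add: closed_simps map_eq_def lunit_lunit_inv)
next
  case counit_right_rule
  then show ?case using counit_right by (simp add: closed_simps map_eq_def runit_runit_inv)
next
  case comult_mult_rule
  then have t: "t \<in> vspace C (B \<otimes> B)" by simp
  let ?a = "tmap C B (B \<otimes> B) B B \<Delta> id t"
  let ?x = "assoc_inv C B B (B \<otimes> B) (tmap C B B (B \<otimes> B \<otimes> B) (B \<otimes> B \<otimes> B) id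
      (assoc C B B B \<circ> tmap C (B \<otimes> B) (B \<otimes> B) B B (braid C B B) id \<circ> assoc_inv C B B B)
      (assoc C B B (B \<otimes> B) (tmap C B (B \<otimes> B) B (B \<otimes> B) \<Delta> \<Delta> t)))"
  have a: "?a \<in> vspace C ((B \<otimes> B) \<otimes> B)"
    by (rule lin_in[OF lin_tmap[OF val_lins(3) lin_id] t])
  \<comment> \<open>The axiom applies both coproducts at once, the diagram one after the other. So
    \<open>\<Delta> \<otimes> \<Delta>\<close> is factored through
    \<open>\<Delta> \<otimes> id\<close>, and naturality of the associator moves the second
    coproduct into right-nested position; the two products are separated likewise below.\<close>
  have "tmap C B (B \<otimes> B) B (B \<otimes> B) \<Delta> \<Delta> t =
      tmap C (B \<otimes> B) (B \<otimes> B) B (B \<otimes> B) (tmap C B B B B id id) \<Delta> ?a"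
    unfolding tmap_comp[OF val_lins(3) lin_id lin_tmap[OF lin_id lin_id] val_lins(3) t]
    by (rule tmap_cong[OF val_lins(3,3) lin_comp[OF val_lins(3) lin_tmap[OF lin_id lin_id]]
        lin_comp[OF lin_id val_lins(3)] _ _ t]) (simp_all add: tmap_id lin_in[OF val_lins(3)])
  then have x1: "assoc C B B (B \<otimes> B) (tmap C B (B \<otimes> B) B (B \<otimes> B) \<Delta> \<Delta> t) =
      tmap C B B (B \<otimes> B) (B \<otimes> B \<otimes> B) id (tmap C B B B (B \<otimes> B) id \<Delta>) (assoc C B B B ?a)"
    using assoc_natural[OF lin_id lin_id val_lins(3) a] by simp
  have "lin ((B \<otimes> B) \<otimes> B) ((B \<otimes> B) \<otimes> B \<otimes> B)
      (assoc_inv C B B (B \<otimes> B) \<circ> tmap C B B (B \<otimes> B \<otimes> B) (B \<otimes> B \<otimes> B) id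
      (assoc C B B B \<circ> tmap C (B \<otimes> B) (B \<otimes> B) B B (braid C B B) id \<circ> assoc_inv C B B B) \<circ>
      tmap C B B (B \<otimes> B) (B \<otimes> B \<otimes> B) id (tmap C B B B (B \<otimes> B) id \<Delta>) \<circ> assoc C B B B)"
    by (intro lin_comp[OF _ assoc_inv_lin] lin_comp[OF assoc_lin] lin_comp[OF assoc_inv_lin]
      lin_comp[OF lin_tmap[OF lin_id lin_tmap[OF lin_id val_lins(3)]]]
      lin_tmap lin_id lin_comp[OF lin_tmap[OF braid_lin lin_id] assoc_lin])
  from lin_in[OF this a] have x: "?x \<in> vspace C ((B \<otimes> B) \<otimes> B \<otimes> B)" using x1 by simp
  have "tmap C (B \<otimes> B) B (B \<otimes> B) B m m ?x =
      tmap C B B (B \<otimes> B) B id m (tmap C (B \<otimes> B) B (B \<otimes> B) (B \<otimes> B) m id ?x)"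
    using tmap_comp[OF val_lins(1) lin_id lin_id val_lins(1) x] by simp
  then show ?case
    using comult_mult t x1 by (simp add: closed_simps map_eq_def braided_tensor_mult_def)
next
  case comult_unit_rule
  then have t: "t \<in> vspace C \<one>" by simp
  have "lunit_inv C B (\<eta> t) = tmap C \<one> \<one> \<one> B id \<eta> (lunit_inv C \<one> t)"
    using tmap_pure[OF lin_id val_lins(2) unit_vec_in t] by (simp add: lunit_inv_def)
  then show ?case
    using comult_unit t tmap_comp[OF lin_id val_lins(2) val_lins(2) lin_id lin_in[OF lunit_inv_lin t]]
    by (simp add: closed_simps map_eq_def)
next
  case counit_mult_rule
  then have t: "t \<in> vspace C (B \<otimes> B)" by simp
  show ?case
    using counit_mult t tmap_comp[OF val_lins(4) lin_id lin_id val_lins(4) t]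
      lunit_natural[OF val_lins(4) lin_in[OF lin_tmap[OF val_lins(4) lin_id] t]]
    by (simp add: closed_simps map_eq_def)
next
  case counit_unit_rule
  then show ?case using counit_unit by (simp add: closed_simps map_eq_def)
next
  case antip_left_rule
  then show ?case using antipode_left by (simp add: closed_simps map_eq_def)
next
  case antip_right_rule
  then show ?case using antipode_right by (simp add: closed_simps map_eq_def)
next
  case cross_mult_right_rule
  then have t: "t \<in> vspace C (B \<otimes> B \<otimes> B)" by simp
  show ?case
    using hexagon_right[OF t] braid_tmap[OF id_hom mult_hom t] lin_in[OF braid_lin t]
    by (simp add: closed_simps assoc_inv_assoc)
next
  case cross_mult_left_rule
  then have t: "t \<in> vspace C (B \<otimes> B \<otimes> B)" by simp
  show ?case
    using hexagon_left[OF t] braid_tmap[OF mult_hom id_hom lin_in[OF assoc_inv_lin t]]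
    by (simp add: closed_simps)
next
  case cross_comult_right_rule
  then have t: "t \<in> vspace C (B \<otimes> B)" by simp
  show ?case
    using hexagon_right[OF lin_in[OF lin_tmap[OF lin_id val_lins(3)] t]]
      braid_tmap[OF id_hom comult_hom t]
    by (simp add: closed_simps)
next
  case cross_comult_left_rule
  then have t: "t \<in> vspace C (B \<otimes> B)" by simp
  have d: "tmap C B (B \<otimes> B) B B \<Delta> id t \<in> vspace C ((B \<otimes> B) \<otimes> B)"
    by (rule lin_in[OF lin_tmap[OF val_lins(3) lin_id] t])
  show ?case
    using hexagon_left[OF lin_in[OF assoc_lin d]] braid_tmap[OF comult_hom id_hom t]
    by (simp add: closed_simps assoc_inv_assoc[OF d])
next
  case cross_unit_right_rule
  then have t: "t \<in> vspace C B" by simp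
  show ?case
    using braid_tmap[OF id_hom unit_hom lin_in[OF runit_inv_lin t]] braid_unit_right[OF t]
    by (simp add: closed_simps)
next
  case cross_unit_left_rule
  then have t: "t \<in> vspace C B" by simp
  show ?case
    using braid_tmap[OF unit_hom id_hom lin_in[OF lunit_inv_lin t]] braid_unit_left[OF t]
    by (simp add: closed_simps)
next
  case cross_counit_right_rule
  then have t: "t \<in> vspace C (B \<otimes> B)" by simp
  show ?case
    using braid_tmap[OF id_hom counit_hom t]
      lunit_braid[OF lin_in[OF lin_tmap[OF lin_id val_lins(4)] t]]
    by (simp add: closed_simps)
next
  case cross_counit_left_rule
  then have t: "t \<in> vspace C (B \<otimes> B)" by simp
  show ?case
    using braid_tmap[OF counit_hom id_hom t]
      runit_braid[OF lin_in[OF lin_tmap[OF val_lins(4) lin_id] t]]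
    by (simp add: closed_simps)
next
  case cross_antip_right_rule
  then show ?case using braid_tmap[OF id_hom antipode_hom] by (simp add: closed_simps)
next
  case cross_antip_left_rule
  then show ?case using braid_tmap[OF antipode_hom id_hom] by (simp add: closed_simps)
next
  case cross_cross_rule
  then have t: "t \<in> vspace C (B \<otimes> B \<otimes> B)" by simp
  \<comment> \<open>The braid relation is naturality of the braiding of \<open>B\<close> with
    \<open>B \<otimes> B\<close> along \<open>\<Psi>\<close> itself, both sides expanded by the
    hexagon.\<close>
  show ?case
    using hexagon_right[OF t] hexagon_right[OF lin_in[OF lin_tmap[OF lin_id braid_lin] t]]
      braid_tmap[OF id_hom braid_hom t] lin_in[OF braid_lin t]
    by (simp add: closed_simps assoc_inv_assoc)
qed

lemma trace_rule_closed:
  assumes "trace_rule u l r" "t \<in> vspace C (ob (obs u))"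
  shows "closed u l t = closed u r t"
  using assms
proof (induction rule: trace_rule.induct)
  case (hopf u l r)
  then show ?case by (rule hopf_rule_closed)
next
  case crossD_comult_rule
  then have t: "t \<in> vspace C (B \<otimes> Bd)" by simp
  have d: "tmap C B (B \<otimes> B) Bd Bd \<Delta> id t \<in> vspace C ((B \<otimes> B) \<otimes> Bd)"
    by (rule lin_in[OF lin_tmap[OF val_lins(3) lin_id] t])
  show ?case
    using hexagon_left[OF lin_in[OF assoc_lin d]] braid_tmap[OF comult_hom id_hom t]
    by (simp add: closed_simps assoc_inv_assoc[OF d])
next
  case crossD_ev_rule
  then have t: "t \<in> vspace C (B \<otimes> Bd \<otimes> B)" by simp
  show ?case
    using hexagon_right[OF t] braid_tmap[OF id_hom ev_hom t] lin_in[OF braid_lin t]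
      lunit_braid[OF lin_in[OF lin_tmap[OF lin_id hom_linear[OF ev_hom]] t]]
    by (simp add: closed_simps assoc_inv_assoc)
next
  case crossD_coev_rule
  then have t: "t \<in> vspace C B" by simp
  note t' = lin_in[OF runit_inv_lin t]
  show ?case
    using hexagon_right[OF lin_in[OF lin_tmap[OF lin_id hom_linear[OF coev_hom]] t']]
      braid_tmap[OF id_hom coev_hom t'] braid_unit_right[OF t]
    by (simp add: closed_simps)
next
  case snake_rule
  then show ?case using dual by (simp add: closed_simps is_dual_def map_eq_def)
qed

section \<open>The integral as a diagram\<close>

definition integral_diagram :: diagram where
  "integral_diagram = [(1, Coev), (1, Antip), (1, Antip), (0, Mult), (0, CrossD), (0, Ev)]"

lemma run_integral_diagram: "run [Alg] integral_diagram = Some []"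
  by (simp add: integral_diagram_def run.simps)

lemma closed_integral_diagram:
  assumes t: "t \<in> vspace C B"
  shows "closed [Alg] integral_diagram t = braided_integral C B Bd ev coev m S t"
proof -
  let ?S = "tmap C B B Bd Bd S id"
  have S: "lin (B \<otimes> Bd) (B \<otimes> Bd) ?S" by (rule lin_tmap[OF val_lins(5) lin_id])
  have c: "tmap C B B \<one> (B \<otimes> Bd) id coev (runit_inv C B t) \<in> vspace C (B \<otimes> B \<otimes> Bd)"
    (is "?w \<in> _")
    by (rule lin_in[OF lin_tmap[OF lin_id hom_linear[OF coev_hom]] lin_in[OF runit_inv_lin t]])
  \<comment> \<open>The diagram applies the antipode in two layers, the composite for the integral
    applies \<open>S \<circ> S\<close> in one.\<close>
  have "tmap C B B (B \<otimes> Bd) (B \<otimes> Bd) id ?S (tmap C B B (B \<otimes> Bd) (B \<otimes> Bd) id ?S ?w) =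
      tmap C B B (B \<otimes> Bd) (B \<otimes> Bd) id (tmap C B B Bd Bd (S \<circ> S) id) ?w"
    unfolding tmap_comp[OF lin_id S lin_id S c]
    by (rule tmap_cong[OF lin_comp[OF lin_id lin_id] lin_comp[OF S S] lin_id
          lin_tmap[OF lin_comp[OF val_lins(5,5)] lin_id] _ _ c])
      (simp_all add: tmap_comp[OF val_lins(5) lin_id val_lins(5) lin_id])
  then show ?thesis
    using braided_integral_composite[OF dual] t
    by (simp add: integral_diagram_def closed_simps map_eq_def)
qed

lemma braided_integral_left_invariant:
  assumes t: "t \<in> vspace C B"
  shows "runit C B (tmap C B B B \<one> id (braided_integral C B Bd ev coev m S) (\<Delta> t)) =
    \<eta> (braided_integral C B Bd ev coev m S t)"
proof -
  let ?I = integral_diagram and ?int = "braided_integral C B Bd ev coev m S"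
  have D: "[(0, Comult), (2, Coev), (2, Antip), (2, Antip), (1, Mult), (1, CrossD), (1, Ev)] =
      (0, Comult) # shift (length [Alg]) ?I"
    "[(1, Coev), (1, Antip), (1, Antip), (0, Mult), (0, CrossD), (0, Ev), (0, Unit)] =
      ?I @ [(0, Unit)]"
    by (simp_all add: integral_diagram_def shift_def)
  have rI: "rep [B] [] (sem [Alg] ?I) (closed [Alg] ?I)"
    using rep_sem[OF run_integral_diagram] by simp
  \<comment> \<open>The whole integral is whiskered at once, which yields
    \<open>id \<otimes> \<integral>\<close> followed by a right unitor as in the theorem. Closing
    the shifted diagram layer by layer would give a different composite; \<open>sem_shift\<close>
    shows that both have the same family.\<close>
  have rl: "rep [B] [B] (\<lambda>Z. tmap C B B (B \<otimes> Z) Z id (sem [Alg] ?I Z) \<circ> layer [] Comult [] Z)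
      (left_closed B [B] [] (closed [Alg] ?I) \<circ> layer_closed [] Comult [])"
    using rep_comp[OF rep_layer[of "[]" Comult "[]"]] rep_left[OF rI, of B] by simp
  have rr: "rep [B] [B] (sem [Alg] (?I @ [(0, Unit)])) (\<eta> \<circ> closed [Alg] ?I)"
    using rep_sem[of "[Alg]" "?I @ [(0, Unit)]" "[Alg]"] run_integral_diagram
    by (simp add: integral_diagram_def closed_simps run.simps comp_def)
  have "left_closed B [B] [] (closed [Alg] ?I) (layer_closed [] Comult [] t) =
      (\<eta> \<circ> closed [Alg] ?I) t"
  proof -
    have "tmap C B B (B \<otimes> Z) Z id (sem [Alg] ?I Z) (layer [] Comult [] Z w) =
        sem [Alg] (?I @ [(0, Unit)]) Z w" if w: "w \<in> vspace C (act [B] Z)" for Z w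
    proof -
      have "layer [] Comult [] Z w \<in> vspace C (act (obs ([Alg] @ [Alg] @ [])) Z)"
        using lin_in[OF lin_layer[of "[]" Comult "[]" Z]] w by simp
      from sem_shift[OF run_integral_diagram this]
      have "sem [Alg] ((0, Comult) # shift (length [Alg]) ?I) Z w =
          tmap C B B (B \<otimes> Z) Z id (sem [Alg] ?I Z) (layer [] Comult [] Z w)" by simp
      moreover have "sem [Alg] ((0, Comult) # shift (length [Alg]) ?I) Z w =
          sem [Alg] (?I @ [(0, Unit)]) Z w"
        unfolding D[symmetric]
      proof (rule deriv_sound[OF _ integral_invariant])
        show "sem u l Y x = sem u r Y x"
          if "trace_rule u l r" "x \<in> vspace C (act (obs u) Y)" for u l r Y x
          using trace_rule_run[OF that(1)] trace_rule_closed[OF that(1)] that(2) sem_eqI by blast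
      qed (use w in simp)
      ultimately show ?thesis by simp
    qed
    then show ?thesis using rep_closed_unique[OF rl rr, of t] t by simp
  qed
  then have "runit C B (tmap C B B B \<one> id (closed [Alg] ?I) (\<Delta> t)) = \<eta> (?int t)"
    by (simp add: closed_simps closed_integral_diagram[OF t])
  \<comment> \<open>The two maps are known to agree only on \<open>B\<close>, and
    \<open>tmap\<close> is defined by choice, so the replacement goes through
    \<open>tmap_cong\<close>; linearity of the integral is inherited from the diagram.\<close>
  moreover have "tmap C B B B \<one> id (closed [Alg] ?I) (\<Delta> t) = tmap C B B B \<one> id ?int (\<Delta> t)"
  proof -
    have l: "lin B \<one> (closed [Alg] ?I)" using repD(1)[OF rI] by simp
    have "lin B \<one> ?int" by (rule lin_cong[OF l closed_integral_diagram[symmetric]])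
    then show ?thesis
      by (rule tmap_cong[OF lin_id l lin_id _ refl closed_integral_diagram lin_in[OF val_lins(3) t]])
  qed
  ultimately show ?thesis by simp
qed

end

theorem mainTheorem6:
  fixes C :: "('o, 'v::ab_group_add, 'm) vect_cat_scheme"
    and B Bd :: 'o
    and m \<eta> \<Delta> \<epsilon> S ev coev :: "'v \<Rightarrow> 'v"
  assumes "braided_group C B m \<eta> \<Delta> \<epsilon> S"
    and "invertible_hom C B B S"
    and "is_dual C B Bd ev coev"
  shows "map_eq C B
           (runit C B \<circ> tmap C B B B \<one>\<^bsub>C\<^esub> id (braided_integral C B Bd ev coev m S) \<circ> \<Delta>)
           (\<eta> \<circ> braided_integral C B Bd ev coev m S)"
proof -
  interpret dual_braided_group C B m \<eta> \<Delta> \<epsilon> S Bd ev coev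
    using assms(1,3) by (simp add: dual_braided_group_def dual_braided_group_axioms_def)
  show ?thesis by (simp add: map_eq_def braided_integral_left_invariant)
qed

end
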